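(* Let $f=\frac1n\sum_{i=1}^n f_i$ with $f_i=\frac1m\sum_{j=1}^m f_{ij}$, where each $f_{ij}:\mathbb{R}^d\to\mathbb{R}$ is $L$-smooth (convexity is not assumed), let $x^\star$ be a minimizer of $f$ and $f^\star=f(x^\star)$. Run the VR-DIANA algorithm (described in the context) with an $\omega$-quantization operator $Q$ and with $$\gamma=\frac{1}{10L\left(1+\frac\omega n\right)^{1/2}\left(m^{2/3}+\omega+1\right)},\qquad\alpha=\frac1{\omega+1}.$$ Then an iterate $x^a$ chosen uniformly at random from $\{x^0,x^1,\dots,x^{k-1}\}$ satisfies $$\mathbb{E}[\|\nabla f(x^a)\|_2^2]\le\frac{40\,(f(x^0)-f^\star)\,L\left(1+\frac\omega n\right)^{1/2}\left(m^{2/3}+\omega+1\right)}{k},$$ where $k$ denotes the number of iterations.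
   Context: A differentiable function $f:\mathbb{R}^d\to\mathbb{R}$ is $L$-smooth ($L>0$) if $f(y)\le f(x)+\langle\nabla f(x),y-x\rangle+\frac L2\|x-y\|_2^2$ for all $x,y\in\mathbb{R}^d$. An $\omega$-quantization operator is a random map $Q:\mathbb{R}^d\to\mathbb{R}^d$ such that for all $x$: $\mathbb{E}_Q[Q(x)]=x$ and $\mathbb{E}_Q[\|Q(x)\|_2^2]\le(\omega+1)\|x\|_2^2$. VR-DIANA algorithm. Input: learning rates $\alpha,\gamma>0$, initial vectors $x^0$, $h_i^0$ and $w_{ij}^0$ in $\mathbb{R}^d$ ($1\le i\le n$, $1\le j\le m$). For $k=0,1,2,\dots$: (Variant 1 only) draw $u^k\in\{0,1\}$ with $P(u^k=1)=\frac1m$. For each worker $i=1,\dots,n$: draw $j_i^k$ uniformly at random from $\{1,\dots,m\}$; set $\mu_i^k=\frac1m\sum_{j=1}^m\nabla f_{ij}(w_{ij}^k)$, $g_i^k=\nabla f_{ij_i^k}(x^k)-\nabla f_{ij_i^k}(w_{ij_i^k}^k)+\mu_i^k$, $\hat\Delta_i^k=Q(g_i^k-h_i^k)$, $h_i^{k+1}=h_i^k+\alpha\hat\Delta_i^k$; and update, for all $j$: in Variant 1 (L-SVRG) $w_{ij}^{k+1}=x^k$ if $u^k=1$ and $w_{ij}^{k+1}=w_{ij}^k$ if $u^k=0$; in Variant 2 (SAGA) $w_{ij}^{k+1}=x^k$ if $j=j_i^k$ and $w_{ij}^{k+1}=w_{ij}^k$ otherwise. Then set $g^k=\frac1n\sum_{i=1}^n(\hat\Delta_i^k+h_i^k)$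 and $x^{k+1}=x^k-\gamma g^k$. The statement covers both variants. All random draws ($u^k$, the $j_i^k$, and the internal randomness of each application of $Q$) are mutually independent and independent of the past, and the index $a$ is independent of them.
   Formalization: As printed the claim is false; the formal theorem assumes in addition that each gradient of f_ij is L-Lipschitz (not only one-sidedly L-smooth) and that the initial vectors are w_ij^0 = x^0 and h_i^0 = ∇f_i(x^0). *)

theory Defs
  imports "HOL-Probability.Probability"
begin

definition gradient :: "('v::real_inner \<Rightarrow> real) \<Rightarrow> 'v \<Rightarrow> 'v" where
  "gradient f x = (THE D. GDERIV f x :> D)"

definition L_smooth :: "real \<Rightarrow> ('v::real_inner \<Rightarrow> real) \<Rightarrow> bool" where
  "L_smooth L f \<longleftrightarrow>
     (\<forall>x. f differentiable (at x)) \<and>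
     (\<forall>x y. f y \<le> f x + gradient f x \<bullet> (y - x) + L / 2 * (norm (x - y))\<^sup>2)"

text \<open>
  A random map is a function of a random seed, distributed according to \<open>R\<close>, and of the point.
  Measurability is required jointly, since the map is applied to random points.
\<close>

definition quantization_operator ::
    "real \<Rightarrow> 'r measure \<Rightarrow> ('r \<Rightarrow> 'v::euclidean_space \<Rightarrow> 'v) \<Rightarrow> bool" where
  "quantization_operator \<omega> R Q \<longleftrightarrow>
     prob_space R \<and>
     (\<lambda>(r, x). Q r x) \<in> borel_measurable (R \<Otimes>\<^sub>M borel) \<and>
     (\<forall>x. integrable R (\<lambda>r. Q r x) \<and> (\<integral>r. Q r x \<partial>R) = x \<and>
          integrable R (\<lambda>r. (norm (Q r x))\<^sup>2) \<and>
          (\<integral>r. (norm (Q r x))\<^sup>2 \<partial>R) \<le> (\<omega> + 1) * (norm x)\<^sup>2)"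

definition worker_obj :: "nat \<Rightarrow> (nat \<Rightarrow> nat \<Rightarrow> 'v \<Rightarrow> real) \<Rightarrow> nat \<Rightarrow> 'v \<Rightarrow> real" where
  "worker_obj m f i x = (\<Sum>j\<in>{1..m}. f i j x) / real m"

definition objective :: "nat \<Rightarrow> nat \<Rightarrow> (nat \<Rightarrow> nat \<Rightarrow> 'v \<Rightarrow> real) \<Rightarrow> 'v \<Rightarrow> real" where
  "objective n m f x = (\<Sum>i\<in>{1..n}. worker_obj m f i x) / real n"

datatype variant = L_SVRG | SAGA

record 'v diana_state =
  iterate :: 'v
  shift :: "nat \<Rightarrow> 'v"
  ref_pt :: "nat \<Rightarrow> nat \<Rightarrow> 'v"

text \<open>
  One iteration, as a deterministic function of the coin \<open>u\<close> (ignored by \<open>SAGA\<close>), the sampled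
  component \<open>J i\<close> of every worker and the quantization seed \<open>\<xi> i\<close> of every worker.
\<close>

definition diana_step ::
    "variant \<Rightarrow> real \<Rightarrow> real \<Rightarrow> nat \<Rightarrow> nat \<Rightarrow> (nat \<Rightarrow> nat \<Rightarrow> 'v \<Rightarrow> real) \<Rightarrow> ('r \<Rightarrow> 'v \<Rightarrow> 'v) \<Rightarrow>
     bool \<Rightarrow> (nat \<Rightarrow> nat) \<Rightarrow> (nat \<Rightarrow> 'r) \<Rightarrow> 'v::euclidean_space diana_state \<Rightarrow> 'v diana_state" where
  "diana_step var \<alpha> \<gamma> n m f Q u J \<xi> s =
     (let x = iterate s; h = shift s; w = ref_pt s;
          \<mu> = (\<lambda>i. (1 / real m) *\<^sub>R (\<Sum>j\<in>{1..m}. gradient (f i j) (w i j)));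
          g = (\<lambda>i. gradient (f i (J i)) x - gradient (f i (J i)) (w i (J i)) + \<mu> i);
          \<Delta> = (\<lambda>i. Q (\<xi> i) (g i - h i));
          h' = (\<lambda>i. h i + \<alpha> *\<^sub>R \<Delta> i);
          w' = (\<lambda>i j. if (case var of L_SVRG \<Rightarrow> u | SAGA \<Rightarrow> j = J i) then x else w i j);
          G = (1 / real n) *\<^sub>R (\<Sum>i\<in>{1..n}. \<Delta> i + h i)
      in \<lparr>iterate = x - \<gamma> *\<^sub>R G, shift = h', ref_pt = w'\<rparr>)"

primrec vr_diana ::
    "variant \<Rightarrow> real \<Rightarrow> real \<Rightarrow> nat \<Rightarrow> nat \<Rightarrow> (nat \<Rightarrow> nat \<Rightarrow> 'v \<Rightarrow> real) \<Rightarrow> ('r \<Rightarrow> 'v \<Rightarrow> 'v) \<Rightarrow>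
     'v \<Rightarrow> (nat \<Rightarrow> 'v) \<Rightarrow> (nat \<Rightarrow> nat \<Rightarrow> 'v) \<Rightarrow>
     (nat \<Rightarrow> bool) \<Rightarrow> (nat \<Rightarrow> nat \<Rightarrow> nat) \<Rightarrow> (nat \<Rightarrow> nat \<Rightarrow> 'r) \<Rightarrow>
     nat \<Rightarrow> 'v::euclidean_space diana_state" where
  "vr_diana var \<alpha> \<gamma> n m f Q x0 h0 w0 u J \<xi> 0 = \<lparr>iterate = x0, shift = h0, ref_pt = w0\<rparr>"
| "vr_diana var \<alpha> \<gamma> n m f Q x0 h0 w0 u J \<xi> (Suc k) =
     diana_step var \<alpha> \<gamma> n m f Q (u k) (J k) (\<xi> k)
       (vr_diana var \<alpha> \<gamma> n m f Q x0 h0 w0 u J \<xi> k)"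

text \<open>
  The draws have different value types, so their mutual independence is stated through the
  sigma-algebras they generate, indexed by the following names. Under \<open>SAGA\<close> there are no coins
  and nothing is required of \<open>u\<close>.
\<close>

datatype draw = Output_Index | Coin nat | Component nat nat | Seed nat nat

definition draws :: "variant \<Rightarrow> nat \<Rightarrow> draw set" where
  "draws var n =
     {Output_Index} \<union> {Coin k | k. var = L_SVRG} \<union>
     {Component k i | k i. i \<in> {1..n}} \<union> {Seed k i | k i. i \<in> {1..n}}"

definition random_draws ::
    "'p measure \<Rightarrow> variant \<Rightarrow> nat \<Rightarrow> nat \<Rightarrow> 'r measure \<Rightarrow> nat \<Rightarrow>
     (nat \<Rightarrow> 'p \<Rightarrow> bool) \<Rightarrow> (nat \<Rightarrow> nat \<Rightarrow> 'p \<Rightarrow> nat) \<Rightarrow> (nat \<Rightarrow> nat \<Rightarrow> 'p \<Rightarrow> 'r) \<Rightarrow>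
     ('p \<Rightarrow> nat) \<Rightarrow> bool" where
  "random_draws M var n m R K u J \<xi> a \<longleftrightarrow>
     a \<in> measurable M (count_space UNIV) \<and>
     distr M (count_space UNIV) a = measure_pmf (pmf_of_set {0..<K}) \<and>
     (var = L_SVRG \<longrightarrow> (\<forall>k. u k \<in> measurable M (count_space UNIV) \<and>
        distr M (count_space UNIV) (u k) = measure_pmf (bernoulli_pmf (1 / real m)))) \<and>
     (\<forall>k. \<forall>i\<in>{1..n}. J k i \<in> measurable M (count_space UNIV) \<and>
        distr M (count_space UNIV) (J k i) = measure_pmf (pmf_of_set {1..m})) \<and>
     (\<forall>k. \<forall>i\<in>{1..n}. \<xi> k i \<in> measurable M R \<and> distr M R (\<xi> k i) = R) \<and>
     prob_space.indep_sets M
       (\<lambda>d. case d of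
              Output_Index \<Rightarrow> sets (vimage_algebra (space M) a (count_space UNIV))
            | Coin k \<Rightarrow> sets (vimage_algebra (space M) (u k) (count_space UNIV))
            | Component k i \<Rightarrow> sets (vimage_algebra (space M) (J k i) (count_space UNIV))
            | Seed k i \<Rightarrow> sets (vimage_algebra (space M) (\<xi> k i) R))
       (draws var n)"

end

theory Submission
  imports Defs
begin

text \<open>
  Why the bound holds. One round of the algorithm is analysed from a fixed state, in which the
  iterate is \<open>x\<close>, the shifts are \<open>h\<^sub>i\<close> and the reference points are \<open>w\<^sub>i\<^sub>j\<close>. The search direction is an
  unbiased estimate of the full gradient \<open>g = \<nabla>f(x)\<close>. Its second moment is at most
  \<open>|g|\<^sup>2 + (\<omega>/n) H + ((\<omega>+1)/n) L\<^sup>2 W\<close>, where \<open>H\<close> is the mean squared distance of the shifts from the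
  worker gradients and \<open>W\<close> the mean squared distance of the reference points from \<open>x\<close>
  (\<open>direction_second_moment\<close>): the workers are independent, so only the sum of their variances enters,
  divided by \<open>n\<^sup>2\<close>. Both errors contract, up to terms that are controlled by this second moment, by
  \<open>|g|\<^sup>2\<close> and, for \<open>H\<close>, by \<open>W\<close>. \<open>W\<close> contracts because a reference point is refreshed with probability \<open>1/m\<close>
  (\<open>mean_ref_error_step\<close>), and \<open>H\<close> because the shifts learn the gradients at rate \<open>\<alpha>\<close>
  (\<open>shift_update_error_expectation\<close>, \<open>shift_error_step_le\<close>). With suitable weights \<open>A\<close> and \<open>B\<close> the
  potential \<open>f(x) - f\<^sup>* + A L W + B H\<close> therefore loses at least \<open>\<gamma>/4 |g|\<^sup>2\<close> in expectation in each
  round (\<open>potential_descent\<close>, with the arithmetic in \<open>lyapunov_coefficients\<close>).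

  The delicate point is the change of \<open>W\<close>. Expanding \<open>|x - \<gamma> G - w|\<^sup>2\<close> produces a cross term between
  the direction \<open>G\<close> and \<open>x - w\<close>, and Young's inequality on \<open>G\<close> itself would only allow step sizes of
  order \<open>1/m\<close>. The cross term has to be averaged first, so that \<open>G\<close> is replaced by \<open>g\<close>; this is
  where the exponent \<open>2/3\<close> comes from. In the SAGA variant the event that \<open>w\<^sub>i\<^sub>j\<close> is refreshed is not
  independent of \<open>G\<close>, because both depend on the component sampled by worker \<open>i\<close>. Conditioning on this
  component shows that the correlation only adds \<open>2 \<gamma> L/(m n) W\<close> (\<open>refreshed_message\<close>,
  \<open>bias_inner_le\<close>), which is small compared with the gain \<open>W/m\<close>.

  The passage from a fixed state to the random one uses independence of the past from the fresh draws.
  The identity of the probability space, regarded once as a map into the sigma-algebra of the past and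
  once as a map into that of the fresh draws, gives two independent random variables, so an
  expectation along the diagonal is an iterated integral (\<open>nn_integral_indep_diagonal\<close>). The potential
  is nonnegative, so the recursion can be run with nonnegative integrals, and integrability of the
  squared gradients is a consequence of the final bound. Summing over the rounds, the expected squared
  gradients of the first \<open>K\<close> iterates add up to at most \<open>4 (f(x\<^sup>0) - f\<^sup>*)/\<gamma>\<close>, the initial potential being
  \<open>f(x\<^sup>0) - f\<^sup>*\<close> since \<open>W\<close> and \<open>H\<close> vanish at the start. An independent uniform index turns this sum
  into an average.
\<close>

section \<open>Gradients\<close>

lemma gradient_eqI:
  fixes f :: "'v::real_inner \<Rightarrow> real"
  assumes "GDERIV f x :> D"
  shows "gradient f x = D"
  unfolding gradient_def
proof (rule the_equality)
  show "GDERIV f x :> D"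
    by (rule assms)
next
  fix D' assume "GDERIV f x :> D'"
  with assms have "(\<lambda>h. h \<bullet> D') = (\<lambda>h. h \<bullet> D)"
    unfolding gderiv_def by (rule has_derivative_unique[symmetric])
  then have "\<And>h. h \<bullet> (D' - D) = 0"
    by (auto simp: inner_diff_right fun_eq_iff)
  from this[of "D' - D"] show "D' = D"
    by simp
qed

lemma GDERIV_gradient:
  fixes f :: "'v::euclidean_space \<Rightarrow> real"
  assumes "f differentiable (at x)"
  shows "GDERIV f x :> gradient f x"
proof -
  obtain F where F: "(f has_derivative F) (at x)"
    using assms by (auto simp: differentiable_def)
  then have lin: "linear F"
    by (rule has_derivative_linear)
  have "F = (\<lambda>h. h \<bullet> (\<Sum>b\<in>Basis. F b *\<^sub>R b))"
  proof
    fix h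
    have "F h = F (\<Sum>b\<in>Basis. (h \<bullet> b) *\<^sub>R b)"
      by (simp add: euclidean_representation)
    also have "\<dots> = h \<bullet> (\<Sum>b\<in>Basis. F b *\<^sub>R b)"
      using lin by (simp add: linear_sum linear_scale inner_sum_right mult.commute)
    finally show "F h = \<dots>" .
  qed
  with F have "GDERIV f x :> (\<Sum>b\<in>Basis. F b *\<^sub>R b)"
    by (simp add: gderiv_def)
  with gradient_eqI[OF this] show ?thesis
    by simp
qed

text \<open>
  The quantification over both \<open>y\<close> and \<open>z\<close>, instead of over \<open>y\<close> with \<open>z = x\<close>, makes this set closed
  for an arbitrary function \<open>f\<close>: the value \<open>f x\<close> at the moving point is not mentioned.
\<close>

definition near_linear :: "('v::real_inner \<Rightarrow> real) \<Rightarrow> real \<Rightarrow> real \<Rightarrow> 'v \<Rightarrow> 'v set" where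
  "near_linear f e d D =
     {x. \<forall>y\<in>ball x d. \<forall>z\<in>ball x d. \<bar>f y - f z - (y - z) \<bullet> D\<bar> \<le> e * (dist x y + dist x z)}"

lemma closed_near_linear: "closed (near_linear f e d D)"
  unfolding closed_sequential_limits
proof (intro allI impI, elim conjE)
  fix X l assume X: "\<forall>i. X i \<in> near_linear f e d D" and l: "X \<longlonglongrightarrow> l"
  show "l \<in> near_linear f e d D"
    unfolding near_linear_def
  proof (intro CollectI ballI)
    fix y z assume y: "y \<in> ball l d" and z: "z \<in> ball l d"
    have lim: "(\<lambda>i. dist (X i) v) \<longlonglongrightarrow> dist l v" for v
      by (intro tendsto_dist l tendsto_const)
    have "\<forall>\<^sub>F i in sequentially. dist (X i) y < d" "\<forall>\<^sub>F i in sequentially. dist (X i) z < d"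
      using y z by (auto intro!: order_tendstoD[OF lim])
    then have "\<forall>\<^sub>F i in sequentially. \<bar>f y - f z - (y - z) \<bullet> D\<bar> \<le> e * (dist (X i) y + dist (X i) z)"
      by eventually_elim (use X in \<open>auto simp: near_linear_def\<close>)
    moreover have "(\<lambda>i. e * (dist (X i) y + dist (X i) z)) \<longlonglongrightarrow> e * (dist l y + dist l z)"
      by (intro tendsto_intros lim)
    ultimately show "\<bar>f y - f z - (y - z) \<bullet> D\<bar> \<le> e * (dist l y + dist l z)"
      by (intro tendsto_lowerbound) auto
  qed
qed

text \<open>
  The slope \<open>D'\<close> only has to be near the gradient, so it may be taken from a countable dense set.
\<close>

lemma GDERIV_imp_near_linear:
  fixes f :: "'v::real_inner \<Rightarrow> real"
  assumes der: "GDERIV f x :> D" and e: "e > 0" and close: "norm (D - D') \<le> e / 2"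
  shows "\<exists>k::nat. x \<in> near_linear f e (1 / Suc k) D'"
proof -
  from der obtain d where d: "d > 0"
    "\<And>y. norm (y - x) < d \<Longrightarrow> norm (f y - f x - (y - x) \<bullet> D) \<le> e / 2 * norm (y - x)"
    using e unfolding gderiv_def has_derivative_at_alt by (meson half_gt_zero)
  obtain k :: nat where k: "1 / Suc k < d"
    using nat_approx_posE[OF d(1)] by auto
  have "\<bar>f y - f z - (y - z) \<bullet> D'\<bar> \<le> e * (dist x y + dist x z)"
    if "y \<in> ball x (1 / Suc k)" "z \<in> ball x (1 / Suc k)" for y z
  proof -
    have y: "\<bar>f y - f x - (y - x) \<bullet> D\<bar> \<le> e / 2 * dist x y"
      and z: "\<bar>f z - f x - (z - x) \<bullet> D\<bar> \<le> e / 2 * dist x z"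
      using d(2)[of y] d(2)[of z] that k by (auto simp: dist_norm norm_minus_commute)
    have "\<bar>(y - z) \<bullet> (D - D')\<bar> \<le> norm (y - z) * norm (D - D')"
      by (rule Cauchy_Schwarz_ineq2)
    also have "\<dots> \<le> (dist x y + dist x z) * (e / 2)"
      using close dist_triangle3[of y z x] by (intro mult_mono) (auto simp: dist_norm)
    finally have "\<bar>(y - z) \<bullet> (D - D')\<bar> \<le> (dist x y + dist x z) * (e / 2)" .
    moreover have "f y - f z - (y - z) \<bullet> D' =
        (f y - f x - (y - x) \<bullet> D) - (f z - f x - (z - x) \<bullet> D) + (y - z) \<bullet> (D - D')"
      by (simp add: inner_diff_left inner_diff_right)
    moreover have "e * (dist x y + dist x z) = e / 2 * dist x y + e / 2 * dist x z + (dist x y + dist x z) * (e / 2)"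
      by (simp add: algebra_simps)
    ultimately show ?thesis
      using y z by linarith
  qed
  then show ?thesis
    unfolding near_linear_def by blast
qed

text \<open>
  Differentiability at \<open>x\<close> means that for every tolerance some slope approximates \<open>f\<close> near \<open>x\<close>. With
  tolerances, radii and slopes from countable sets, the set of such points is a countable intersection
  of countable unions of closed sets. Compactness of \<open>C\<close> makes the approximating slopes for shrinking
  tolerances accumulate at a point of \<open>C\<close>, which is then the gradient.
\<close>

lemma borel_GDERIV_in_compact:
  fixes f :: "'v::euclidean_space \<Rightarrow> real"
  assumes C: "compact C"
  shows "{x. \<exists>D\<in>C. GDERIV f x :> D} \<in> sets borel"
proof -
  obtain S :: "'v set" where S: "countable S" "\<And>X. open X \<Longrightarrow> X \<noteq> {} \<Longrightarrow> \<exists>d\<in>S. d \<in> X"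
    by (rule countable_dense_setE) blast
  define S' where "S' i = {D\<in>S. \<exists>D'\<in>C. dist D D' \<le> 1 / Suc i}" for i :: nat
  define e :: "nat \<Rightarrow> real" where "e i = 2 / Suc i" for i
  have "{x. \<exists>D\<in>C. GDERIV f x :> D} = (\<Inter>i. \<Union>k::nat. \<Union>D\<in>S' i. near_linear f (e i) (1 / Suc k) D)"
    (is "?A = ?B")
  proof (intro equalityI subsetI)
    fix x assume "x \<in> ?A"
    then obtain D where D: "D \<in> C" "GDERIV f x :> D"
      by blast
    show "x \<in> ?B"
    proof
      fix i :: nat
      obtain D' where D': "D' \<in> S" "D' \<in> ball D (1 / Suc i)"
        using S(2)[of "ball D (1 / Suc i)"] by auto
      then have "D' \<in> S' i"
        using D by (auto simp: S'_def dist_commute intro: less_imp_le bexI[of _ D])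
      moreover have "\<exists>k::nat. x \<in> near_linear f (e i) (1 / Suc k) D'"
      proof (rule GDERIV_imp_near_linear[OF D(2)])
        have "e i / 2 = 1 / Suc i"
          by (simp add: e_def field_simps)
        then show "norm (D - D') \<le> e i / 2"
          using D'(2) by (simp only: mem_ball dist_norm less_imp_le)
      qed (simp add: e_def)
      ultimately show "x \<in> (\<Union>k::nat. \<Union>D\<in>S' i. near_linear f (e i) (1 / Suc k) D)"
        by blast
    qed
  next
    fix x assume "x \<in> ?B"
    then have "\<forall>i. \<exists>k. \<exists>D. \<exists>D'. D' \<in> C \<and> dist D D' \<le> 1 / Suc i \<and> x \<in> near_linear f (e i) (1 / Suc k) D"
      unfolding S'_def by blast
    then obtain k D D' where D': "\<And>i. D' i \<in> C" and D: "\<And>i. dist (D i) (D' i) \<le> 1 / Suc i"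
      and nl: "\<And>i. x \<in> near_linear f (e i) (1 / Suc (k i)) (D i)"
      by metis
    obtain E \<sigma> where E: "E \<in> C" "strict_mono (\<sigma> :: nat \<Rightarrow> nat)" "(D' \<circ> \<sigma>) \<longlonglongrightarrow> E"
      using C D' unfolding compact_def by metis
    have "GDERIV f x :> E"
      unfolding gderiv_def has_derivative_at_alt
    proof (intro conjI allI impI bounded_linear_inner_left)
      fix \<epsilon> :: real assume "\<epsilon> > 0"
      have "(\<lambda>j. e j + 1 / Suc j) \<longlonglongrightarrow> 0"
        unfolding e_def using lim_1_over_n[THEN LIMSEQ_Suc]
        by (auto intro!: tendsto_eq_intros tendsto_divide_0 filterlim_real_sequentially
          simp: filterlim_Suc filterlim_at_top_imp_at_infinity divide_inverse LIMSEQ_inverse_real_of_nat)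
      from LIMSEQ_subseq_LIMSEQ[OF this E(2)]
      have "(\<lambda>j. e (\<sigma> j) + 1 / Suc (\<sigma> j) + dist (D' (\<sigma> j)) E) \<longlonglongrightarrow> 0 + dist E E"
        using E(3) by (intro tendsto_add tendsto_dist tendsto_const) (auto simp: o_def)
      then have "\<forall>\<^sub>F j in sequentially. e (\<sigma> j) + 1 / Suc (\<sigma> j) + dist (D' (\<sigma> j)) E < \<epsilon>"
        using \<open>\<epsilon> > 0\<close> by (intro order_tendstoD) auto
      then obtain j where j: "e (\<sigma> j) + 1 / Suc (\<sigma> j) + dist (D' (\<sigma> j)) E < \<epsilon>"
        by (auto simp: eventually_sequentially)
      have DE: "e (\<sigma> j) + norm (D (\<sigma> j) - E) \<le> \<epsilon>"
        using j D[of "\<sigma> j"] dist_triangle[of "D (\<sigma> j)" E "D' (\<sigma> j)"] by (simp add: dist_norm)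
      show "\<exists>d>0. \<forall>y. norm (y - x) < d \<longrightarrow> norm (f y - f x - (y - x) \<bullet> E) \<le> \<epsilon> * norm (y - x)"
      proof (intro exI[of _ "1 / Suc (k (\<sigma> j))"] conjI allI impI)
        fix y assume "norm (y - x) < 1 / Suc (k (\<sigma> j))"
        then have "y \<in> ball x (1 / Suc (k (\<sigma> j)))" "x \<in> ball x (1 / Suc (k (\<sigma> j)))"
          by (simp_all add: dist_norm norm_minus_commute)
        with nl[of "\<sigma> j"] have "\<bar>f y - f x - (y - x) \<bullet> D (\<sigma> j)\<bar> \<le> e (\<sigma> j) * (dist x y + dist x x)"
          unfolding near_linear_def by blast
        then have "\<bar>f y - f x - (y - x) \<bullet> D (\<sigma> j)\<bar> \<le> e (\<sigma> j) * norm (y - x)"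
          by (simp add: dist_norm norm_minus_commute)
        moreover have "\<bar>(y - x) \<bullet> (D (\<sigma> j) - E)\<bar> \<le> norm (y - x) * norm (D (\<sigma> j) - E)"
          by (rule Cauchy_Schwarz_ineq2)
        moreover have "(e (\<sigma> j) + norm (D (\<sigma> j) - E)) * norm (y - x) \<le> \<epsilon> * norm (y - x)"
          using DE by (intro mult_right_mono) auto
        ultimately show "norm (f y - f x - (y - x) \<bullet> E) \<le> \<epsilon> * norm (y - x)"
          by (simp add: inner_diff_right algebra_simps)
      qed auto
    qed
    with E show "x \<in> ?A"
      by blast
  qed
  also have "\<dots> \<in> sets borel"
    using S(1) borel_closed[OF closed_near_linear]
    by (intro sets.countable_INT sets.countable_UN' sets.countable_UN)
       (auto simp: S'_def intro!: sets.countable_INT sets.countable_UN' sets.countable_UN)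
  finally show ?thesis .
qed

text \<open>
  Measurability of the iterates on the whole probability space rests on this lemma: on a null set the
  sampled index of a component may lie outside \<open>{1..m}\<close>, and there the algorithm evaluates gradients of
  functions about which nothing is known. Where \<open>f\<close> is not differentiable, \<open>gradient f\<close> is the constant
  \<open>THE D. False\<close>.
\<close>

lemma borel_measurable_gradient [measurable]:
  fixes f :: "'v::euclidean_space \<Rightarrow> real"
  shows "gradient f \<in> borel_measurable borel"
proof -
  let ?G = "\<lambda>C. {x. \<exists>D\<in>C. GDERIV f x :> D}"
  have closed: "?G C \<in> sets borel" if "closed C" for C
  proof -
    have "C = (\<Union>r::nat. C \<inter> cball 0 r)"
      using real_arch_simple by auto
    then have "?G C = (\<Union>r::nat. ?G (C \<inter> cball 0 r))"
      by blast
    also have "\<dots> \<in> sets borel"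
      using that by (intro sets.countable_UN) (auto intro!: borel_GDERIV_in_compact)
    finally show ?thesis .
  qed
  show ?thesis
    unfolding borel_measurable_iff_halfspace_le
  proof (intro ballI allI)
    fix b :: 'v and c :: real
    let ?H = "{D. D \<bullet> b \<le> c}" and ?D0 = "THE D::'v. False"
    have "closed ?H"
      by (simp add: closed_halfspace_component_le)
    have nondiff: "gradient f x = ?D0" if "x \<notin> ?G UNIV" for x
    proof -
      have "gderiv f x = (\<lambda>_. False)"
        using that by auto
      then show ?thesis
        unfolding gradient_def by simp
    qed
    have diff: "gradient f x \<bullet> b \<le> c \<longleftrightarrow> x \<in> ?G ?H" if "x \<in> ?G UNIV" for x
      using that gradient_eqI[of f x] by fastforce
    have "{x \<in> space borel. gradient f x \<bullet> b \<le> c} =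
        ?G ?H \<union> (if ?D0 \<bullet> b \<le> c then - ?G UNIV else {})"
      (is "?A = ?B")
    proof (rule set_eqI)
      fix x show "x \<in> ?A \<longleftrightarrow> x \<in> ?B"
        using nondiff[of x] diff[of x] by (cases "x \<in> ?G UNIV") auto
    qed
    also have "\<dots> \<in> sets borel"
      using closed[OF \<open>closed ?H\<close>] closed[of UNIV] by (auto intro: borel_comp)
    finally show "{x \<in> space borel. gradient f x \<bullet> b \<le> c} \<in> sets borel" .
  qed
qed

lemma GDERIV_average:
  fixes g :: "'i \<Rightarrow> 'v::real_inner \<Rightarrow> real"
  assumes "\<And>i. i \<in> A \<Longrightarrow> GDERIV (g i) x :> D i"
  shows "GDERIV (\<lambda>x. (\<Sum>i\<in>A. g i x) / c) x :> (\<Sum>i\<in>A. D i) /\<^sub>R c"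
proof -
  have "((\<lambda>x. inverse c * (\<Sum>i\<in>A. g i x)) has_derivative (\<lambda>h. inverse c * (\<Sum>i\<in>A. h \<bullet> D i))) (at x)"
    using assms unfolding gderiv_def
    by (intro has_derivative_mult_right has_derivative_sum)
  then show ?thesis
    unfolding gderiv_def by (simp add: inner_sum_right divide_inverse mult.commute)
qed

section \<open>Expectations under independence\<close>

text \<open>
  Independence of two sub-sigma-algebras is independence of the identity map, seen as a random variable
  with values in either of them. No product space of states and draws has to be constructed.
\<close>

lemma (in prob_space) indep_set_imp_indep_var_id:
  assumes indep: "indep_set (sets F) (sets G)" and sp: "space F = space M" "space G = space M"
  shows "indep_var F (\<lambda>p. p) G (\<lambda>p. p)"
proof -
  have *: "sigma_sets (space M) {(\<lambda>p. p) -` A \<inter> space M |A. A \<in> sets H} = sets H"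
    if "space H = space M" for H :: "'a measure"
  proof -
    have "A \<inter> space M = A" if "A \<in> sets H" for A
      using sets.sets_into_space[OF that] \<open>space H = space M\<close> by blast
    then have "(\<lambda>A. A \<inter> space M) ` sets H = (\<lambda>A. A) ` sets H"
      by (rule image_cong[OF refl])
    then have "{(\<lambda>p. p) -` A \<inter> space M |A. A \<in> sets H} = sets H"
      by (simp add: Setcompr_eq_image)
    then show ?thesis
      using sets.sigma_sets_eq[of H] that by simp
  qed
  have **: "(\<lambda>p. p) \<in> measurable M H" if "sets H \<subseteq> events" "space H = space M" for H :: "'a measure"
  proof (rule measurableI)
    fix A assume "A \<in> sets H"
    then have "A \<in> events" using that by blast
    then show "(\<lambda>p. p) -` A \<inter> space M \<in> events" by simp
  qed (use that in simp)
  show ?thesis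
    unfolding indep_var_eq *[OF sp(1)] *[OF sp(2)]
    using indep **[OF indep_setD_ev1[OF indep] sp(1)] **[OF indep_setD_ev2[OF indep] sp(2)] by blast
qed

text \<open>
  Freezing the independent part: if \<open>\<Phi> p p'\<close> depends on \<open>p\<close> through \<open>F\<close> and on \<open>p'\<close> through \<open>G\<close>, then
  the diagonal has the law of the product, and Tonelli's theorem applies.
\<close>

lemma (in prob_space) nn_integral_indep_diagonal:
  assumes indep: "indep_set (sets F) (sets G)" and sp: "space F = space M" "space G = space M"
    and \<Phi>: "(\<lambda>(p, p'). \<Phi> p p') \<in> borel_measurable (F \<Otimes>\<^sub>M G)"
  shows "(\<integral>\<^sup>+p. \<Phi> p p \<partial>M) = (\<integral>\<^sup>+p. \<integral>\<^sup>+p'. \<Phi> p p' \<partial>M \<partial>M)"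
proof -
  have iv: "indep_var F (\<lambda>p. p) G (\<lambda>p. p)"
    by (rule indep_set_imp_indep_var_id[OF indep sp])
  then have rv: "(\<lambda>p. p) \<in> measurable M F" "(\<lambda>p. p) \<in> measurable M G"
    by (blast dest: indep_var_rv1 indep_var_rv2)+
  interpret G: prob_space "distr M G (\<lambda>p. p)"
    using rv by (intro prob_space_distr)
  have \<Phi>': "(\<lambda>(p, p'). \<Phi> p p') \<in> borel_measurable (distr M F (\<lambda>p. p) \<Otimes>\<^sub>M distr M G (\<lambda>p. p))"
    using \<Phi> by (simp cong: measurable_cong_sets)
  have "(\<integral>\<^sup>+p. \<Phi> p p \<partial>M) = (\<integral>\<^sup>+z. (case z of (p, p') \<Rightarrow> \<Phi> p p') \<partial>distr M (F \<Otimes>\<^sub>M G) (\<lambda>p. (p, p)))"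
    using \<Phi> rv by (subst nn_integral_distr) auto
  also have "\<dots> = (\<integral>\<^sup>+z. (case z of (p, p') \<Rightarrow> \<Phi> p p') \<partial>(distr M F (\<lambda>p. p) \<Otimes>\<^sub>M distr M G (\<lambda>p. p)))"
    using iv by (simp add: indep_var_distribution_eq)
  also have "\<dots> = (\<integral>\<^sup>+p. \<integral>\<^sup>+p'. \<Phi> p p' \<partial>distr M G (\<lambda>p. p) \<partial>distr M F (\<lambda>p. p))"
    by (simp add: G.nn_integral_fst[OF \<Phi>', symmetric])
  also have "\<dots> = (\<integral>\<^sup>+p. \<integral>\<^sup>+p'. \<Phi> p p' \<partial>distr M G (\<lambda>p. p) \<partial>M)"
  proof (rule nn_integral_distr[OF rv(1)])
    show "(\<lambda>p. \<integral>\<^sup>+p'. \<Phi> p p' \<partial>distr M G (\<lambda>p. p)) \<in> borel_measurable (distr M F (\<lambda>p. p))"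
      using G.borel_measurable_nn_integral_fst[OF \<Phi>'] by simp
  qed
  also have "\<dots> = (\<integral>\<^sup>+p. \<integral>\<^sup>+p'. \<Phi> p p' \<partial>M \<partial>M)"
  proof (rule nn_integral_cong)
    fix p assume "p \<in> space M"
    then have "(\<lambda>p'. \<Phi> p p') \<in> borel_measurable G"
      using measurable_compose[OF measurable_Pair1' \<Phi>, of p] sp by simp
    then show "(\<integral>\<^sup>+p'. \<Phi> p p' \<partial>distr M G (\<lambda>p. p)) = (\<integral>\<^sup>+p'. \<Phi> p p' \<partial>M)"
      by (intro nn_integral_distr[OF rv(2)]) simp
  qed
  finally show ?thesis .
qed

lemma (in prob_space) indep_set_imp_uncorrelated:
  fixes X Y :: "'a \<Rightarrow> 'v::euclidean_space"
  assumes indep: "indep_set (sets F) (sets G)" and sp: "space F = space M" "space G = space M"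
    and X: "X \<in> borel_measurable F" "integrable M X" and Y: "Y \<in> borel_measurable G" "integrable M Y"
  shows "integrable M (\<lambda>p. X p \<bullet> Y p)" "expectation (\<lambda>p. X p \<bullet> Y p) = expectation X \<bullet> expectation Y"
proof -
  have iv: "indep_var borel (\<lambda>p. X p \<bullet> b) borel (\<lambda>p. Y p \<bullet> b)" for b
    using indep_var_compose[OF indep_set_imp_indep_var_id[OF indep sp],
      of "\<lambda>p. X p \<bullet> b" borel "\<lambda>p. Y p \<bullet> b" borel] X(1) Y(1)
    by (simp add: comp_def)
  have int: "integrable M (\<lambda>p. X p \<bullet> b)" "integrable M (\<lambda>p. Y p \<bullet> b)" for b
    using X Y by auto
  have eq: "(\<lambda>p. X p \<bullet> Y p) = (\<lambda>p. \<Sum>b\<in>Basis. (X p \<bullet> b) * (Y p \<bullet> b))"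
    by (rule ext) (rule euclidean_inner)
  show "integrable M (\<lambda>p. X p \<bullet> Y p)"
    unfolding eq by (intro Bochner_Integration.integrable_sum indep_var_integrable[OF iv] int)
  have "expectation (\<lambda>p. X p \<bullet> Y p) = (\<Sum>b\<in>Basis. expectation (\<lambda>p. X p \<bullet> b) * expectation (\<lambda>p. Y p \<bullet> b))"
    unfolding eq by (subst Bochner_Integration.integral_sum)
      (auto intro!: indep_var_integrable[OF iv] int sum.cong indep_var_lebesgue_integral[OF iv])
  also have "\<dots> = expectation X \<bullet> expectation Y"
    using X(2) Y(2) by (subst euclidean_inner) simp
  finally show "expectation (\<lambda>p. X p \<bullet> Y p) = expectation X \<bullet> expectation Y" .
qed

lemma (in prob_space) indep_set_expectation_scaleR:
  fixes X :: "'a \<Rightarrow> real" and Y :: "'a \<Rightarrow> 'v::euclidean_space"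
  assumes indep: "indep_set (sets F) (sets G)" and sp: "space F = space M" "space G = space M"
    and X: "X \<in> borel_measurable F" "integrable M X" and Y: "Y \<in> borel_measurable G" "integrable M Y"
  shows "integrable M (\<lambda>p. X p *\<^sub>R Y p)" "expectation (\<lambda>p. X p *\<^sub>R Y p) = expectation X *\<^sub>R expectation Y"
proof -
  have comp: "integrable M (\<lambda>p. X p * (Y p \<bullet> b))"
    "expectation (\<lambda>p. X p * (Y p \<bullet> b)) = expectation X * (expectation Y \<bullet> b)" for b
    using indep_set_imp_uncorrelated[OF indep sp X, of "\<lambda>p. Y p \<bullet> b"] Y by auto
  have eq: "(\<lambda>p. X p *\<^sub>R Y p) = (\<lambda>p. \<Sum>b\<in>Basis. (X p * (Y p \<bullet> b)) *\<^sub>R b)"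
    by (rule ext) (simp only: scaleR_scaleR[symmetric] scaleR_sum_right[symmetric] euclidean_representation)
  show int: "integrable M (\<lambda>p. X p *\<^sub>R Y p)"
    unfolding eq by (intro Bochner_Integration.integrable_sum integrable_scaleR_left comp)
  show "expectation (\<lambda>p. X p *\<^sub>R Y p) = expectation X *\<^sub>R expectation Y"
  proof (rule euclidean_eqI)
    fix b :: 'v
    show "expectation (\<lambda>p. X p *\<^sub>R Y p) \<bullet> b = (expectation X *\<^sub>R expectation Y) \<bullet> b"
      using comp(2)[of b] int by (subst integral_inner_left[symmetric]) auto
  qed
qed

lemma expectation_norm_sum_sq:
  fixes Z :: "'i \<Rightarrow> 'p \<Rightarrow> 'v::real_inner"
  assumes sq: "\<And>i. i \<in> I \<Longrightarrow> integrable M (\<lambda>p. (norm (Z i p))\<^sup>2)"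
    and cross: "\<And>i j. i \<in> I \<Longrightarrow> j \<in> I \<Longrightarrow> i \<noteq> j \<Longrightarrow> integrable M (\<lambda>p. Z i p \<bullet> Z j p)"
      "\<And>i j. i \<in> I \<Longrightarrow> j \<in> I \<Longrightarrow> i \<noteq> j \<Longrightarrow> (\<integral>p. Z i p \<bullet> Z j p \<partial>M) = 0"
    and "finite I"
  shows "integrable M (\<lambda>p. (norm (\<Sum>i\<in>I. Z i p))\<^sup>2)"
    and "(\<integral>p. (norm (\<Sum>i\<in>I. Z i p))\<^sup>2 \<partial>M) = (\<Sum>i\<in>I. \<integral>p. (norm (Z i p))\<^sup>2 \<partial>M)"
proof -
  have eq: "(\<lambda>p. (norm (\<Sum>i\<in>I. Z i p))\<^sup>2) = (\<lambda>p. \<Sum>i\<in>I. \<Sum>j\<in>I. Z i p \<bullet> Z j p)"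
    by (rule ext) (simp only: power2_norm_eq_inner inner_sum_left inner_sum_right, rule sum.swap)
  have int: "integrable M (\<lambda>p. Z i p \<bullet> Z j p)" if "i \<in> I" "j \<in> I" for i j
    using sq[OF that(1)] cross(1)[OF that] by (cases "i = j") (auto simp: power2_norm_eq_inner)
  show "integrable M (\<lambda>p. (norm (\<Sum>i\<in>I. Z i p))\<^sup>2)"
    unfolding eq by (intro Bochner_Integration.integrable_sum int)
  have "(\<integral>p. (norm (\<Sum>i\<in>I. Z i p))\<^sup>2 \<partial>M) = (\<Sum>i\<in>I. \<Sum>j\<in>I. \<integral>p. Z i p \<bullet> Z j p \<partial>M)"
    unfolding eq using int by (simp add: Bochner_Integration.integral_sum)
  also have "\<dots> = (\<Sum>i\<in>I. \<Sum>j\<in>I. if j = i then \<integral>p. (norm (Z i p))\<^sup>2 \<partial>M else 0)"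
    using cross(2) by (intro sum.cong refl) (auto simp: power2_norm_eq_inner)
  also have "\<dots> = (\<Sum>i\<in>I. \<integral>p. (norm (Z i p))\<^sup>2 \<partial>M)"
    using \<open>finite I\<close> by (intro sum.cong refl) simp
  finally show "(\<integral>p. (norm (\<Sum>i\<in>I. Z i p))\<^sup>2 \<partial>M) = (\<Sum>i\<in>I. \<integral>p. (norm (Z i p))\<^sup>2 \<partial>M)" .
qed

lemma
  fixes g :: "'i \<Rightarrow> 'p \<Rightarrow> real"
  assumes "\<And>i. i \<in> A \<Longrightarrow> integrable M (g i)"
  shows integrable_average: "integrable M (\<lambda>p. (\<Sum>i\<in>A. g i p) / c)"
    and integral_average: "(\<integral>p. (\<Sum>i\<in>A. g i p) / c \<partial>M) = (\<Sum>i\<in>A. \<integral>p. g i p \<partial>M) / c"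
  using assms by (auto simp: Bochner_Integration.integral_sum)

section \<open>Measurability of one round\<close>

text \<open>
  Only the workers \<open>1..n\<close> carry information. All reference points of such a worker are included, since a
  sampled component may be any natural number on a null set.
\<close>

definition measurable_state :: "'p measure \<Rightarrow> nat \<Rightarrow> ('p \<Rightarrow> 'v::euclidean_space diana_state) \<Rightarrow> bool" where
  "measurable_state N n s \<longleftrightarrow>
     (\<lambda>p. iterate (s p)) \<in> borel_measurable N \<and>
     (\<forall>i\<in>{1..n}. (\<lambda>p. shift (s p) i) \<in> borel_measurable N) \<and>
     (\<forall>i\<in>{1..n}. \<forall>j. (\<lambda>p. ref_pt (s p) i j) \<in> borel_measurable N)"

lemma measurable_state_compose:
  assumes "h \<in> measurable N' N" "measurable_state N n s"
  shows "measurable_state N' n (\<lambda>z. s (h z))"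
  using assms unfolding measurable_state_def by (auto intro: measurable_compose[OF assms(1)])

lemma measurable_diana_step:
  fixes s :: "'p \<Rightarrow> 'v::euclidean_space diana_state"
  assumes Q: "(\<lambda>(r, x). Q r x) \<in> borel_measurable (R \<Otimes>\<^sub>M borel)"
    and s: "measurable_state N n s"
    and U: "var = L_SVRG \<Longrightarrow> U \<in> measurable N (count_space UNIV)"
    and J: "\<And>i. i \<in> {1..n} \<Longrightarrow> J i \<in> measurable N (count_space UNIV)"
    and \<xi>: "\<And>i. i \<in> {1..n} \<Longrightarrow> \<xi> i \<in> measurable N R"
  shows "measurable_state N n
    (\<lambda>p. diana_step var \<alpha> \<gamma> n m f Q (U p) (\<lambda>i. J i p) (\<lambda>i. \<xi> i p) (s p))"
proof -
  have x: "(\<lambda>p. iterate (s p)) \<in> borel_measurable N"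
    and h: "\<And>i. i \<in> {1..n} \<Longrightarrow> (\<lambda>p. shift (s p) i) \<in> borel_measurable N"
    and w: "\<And>i j. i \<in> {1..n} \<Longrightarrow> (\<lambda>p. ref_pt (s p) i j) \<in> borel_measurable N"
    using s by (auto simp: measurable_state_def)
  define v where "v i p = gradient (f i (J i p)) (iterate (s p))
      - gradient (f i (J i p)) (ref_pt (s p) i (J i p))
      + (1 / real m) *\<^sub>R (\<Sum>j\<in>{1..m}. gradient (f i j) (ref_pt (s p) i j)) - shift (s p) i" for i p
  have v: "v i \<in> borel_measurable N" if "i \<in> {1..n}" for i
  proof -
    have "(\<lambda>p. gradient (f i (J i p)) (iterate (s p)) - gradient (f i (J i p)) (ref_pt (s p) i (J i p)))
        \<in> borel_measurable N"
      by (rule measurable_compose_countable[OF _ J[OF that],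
          where f="\<lambda>j p. gradient (f i j) (iterate (s p)) - gradient (f i j) (ref_pt (s p) i j)"])
        (intro borel_measurable_diff measurable_compose[OF x borel_measurable_gradient]
          measurable_compose[OF w[OF that] borel_measurable_gradient])
    moreover have "(\<lambda>p. gradient (f i j) (ref_pt (s p) i j)) \<in> borel_measurable N" for j
      by (rule measurable_compose[OF w[OF that] borel_measurable_gradient])
    ultimately show ?thesis
      unfolding v_def using h[OF that] by measurable
  qed
  have \<Delta>: "(\<lambda>p. Q (\<xi> i p) (v i p)) \<in> borel_measurable N" if "i \<in> {1..n}" for i
    using measurable_compose[OF measurable_Pair[OF \<xi>[OF that] v[OF that]] Q] by simp
  have "(\<lambda>p. iterate (s p) - \<gamma> *\<^sub>R (1 / real n) *\<^sub>R (\<Sum>i\<in>{1..n}. Q (\<xi> i p) (v i p) + shift (s p) i))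
      \<in> borel_measurable N"
    by (intro borel_measurable_diff borel_measurable_scaleR borel_measurable_sum borel_measurable_add
        borel_measurable_const x \<Delta> h)
  moreover have "(\<lambda>p. shift (s p) i + \<alpha> *\<^sub>R Q (\<xi> i p) (v i p)) \<in> borel_measurable N" if "i \<in> {1..n}" for i
    using h[OF that] \<Delta>[OF that] by measurable
  moreover have "(\<lambda>p. if (case var of L_SVRG \<Rightarrow> U p | SAGA \<Rightarrow> j = J i p) then iterate (s p)
      else ref_pt (s p) i j) \<in> borel_measurable N" if "i \<in> {1..n}" for i j
  proof (cases var)
    case L_SVRG
    with U have [measurable]: "U \<in> measurable N (count_space UNIV)"
      by simp
    show ?thesis
      using x w[OF that, of j] L_SVRG by simp
  next
    case SAGA
    have [measurable]: "J i \<in> measurable N (count_space UNIV)"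
      by (rule J[OF that])
    show ?thesis
      using x w[OF that, of j] SAGA by simp
  qed
  ultimately show ?thesis
    unfolding measurable_state_def diana_step_def Let_def v_def by simp
qed

section \<open>The information carried by the draws\<close>

text \<open>
  The sigma-algebra \<open>known A\<close> contains what the draws with names in \<open>A\<close> reveal. Disjoint sets of
  names give independent sigma-algebras, which is the form in which independence is used throughout.
\<close>

locale diana_draws = prob_space M for M :: "'p measure" +
  fixes var :: variant and n m :: nat and R :: "'r measure" and K :: nat
    and u :: "nat \<Rightarrow> 'p \<Rightarrow> bool" and J :: "nat \<Rightarrow> nat \<Rightarrow> 'p \<Rightarrow> nat" and \<xi> :: "nat \<Rightarrow> nat \<Rightarrow> 'p \<Rightarrow> 'r"
    and a :: "'p \<Rightarrow> nat"
  assumes draws: "random_draws M var n m R K u J \<xi> a"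
    and m_pos: "m \<ge> 1" and K_pos: "K \<ge> 1"
begin

definition draw_events :: "draw \<Rightarrow> 'p set set" where
  "draw_events d = (case d of
      Output_Index \<Rightarrow> sets (vimage_algebra (space M) a (count_space UNIV))
    | Coin k \<Rightarrow> sets (vimage_algebra (space M) (u k) (count_space UNIV))
    | Component k i \<Rightarrow> sets (vimage_algebra (space M) (J k i) (count_space UNIV))
    | Seed k i \<Rightarrow> sets (vimage_algebra (space M) (\<xi> k i) R))"

definition known :: "draw set \<Rightarrow> 'p measure" where
  "known A = sigma (space M) (\<Union>d\<in>A. draw_events d)"

lemma draw_events_subset: "draw_events d \<subseteq> Pow (space M)"
  by (cases d) (auto simp: draw_events_def dest!: sets.sets_into_space)

lemma space_known [simp]: "space (known A) = space M"
  unfolding known_def by (rule space_measure_of) (use draw_events_subset in blast)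

lemma sets_known: "sets (known A) = sigma_sets (space M) (\<Union>d\<in>A. draw_events d)"
  unfolding known_def by (rule sets_measure_of) (use draw_events_subset in blast)

lemma indep_draw_events: "indep_sets draw_events (draws var n)"
  using draws unfolding random_draws_def draw_events_def by blast

lemma Int_stable_draw_events: "Int_stable (draw_events d)"
  by (auto simp: draw_events_def Int_stable_def split: draw.splits)

lemma measurable_knownI:
  assumes "A \<subseteq> draws var n" "g \<in> measurable (known A) N"
  shows "g \<in> measurable M N"
proof -
  have "sets (known A) \<subseteq> events"
    unfolding sets_known using indep_draw_events assms(1)
    by (intro sets.sigma_sets_subset) (auto simp: indep_sets_def)
  then show ?thesis
    using assms(2) by (auto simp: measurable_def)
qed

lemma measurable_known_mono:
  assumes "A \<subseteq> B" "g \<in> measurable (known A) N"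
  shows "g \<in> measurable (known B) N"
proof -
  have "sets (known A) \<subseteq> sets (known B)"
    unfolding sets_known using assms(1) by (intro sigma_sets_mono') blast
  then show ?thesis
    using assms(2) by (auto simp: measurable_def)
qed

lemma indep_known:
  assumes "A \<subseteq> draws var n" "B \<subseteq> draws var n" "A \<inter> B = {}"
  shows "indep_set (sets (known A)) (sets (known B))"
proof -
  have "indep_sets (\<lambda>b. sigma_sets (space M) (\<Union>d\<in>case_bool A B b. draw_events d)) UNIV"
  proof (rule indep_sets_collect_sigma)
    show "indep_sets draw_events (\<Union>b\<in>UNIV. case_bool A B b)"
      by (rule indep_sets_mono_index[OF _ indep_draw_events]) (use assms in \<open>auto split: bool.splits\<close>)
    show "disjoint_family_on (case_bool A B) UNIV"
      using assms(3) by (auto simp: disjoint_family_on_def split: bool.splits)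
  qed (rule Int_stable_draw_events)
  then show ?thesis
    unfolding indep_set_def sets_known by (rule back_subst[of "\<lambda>E. indep_sets E UNIV"]) (auto split: bool.splits)
qed

lemma measurable_draw:
  assumes "draw_events d = sets (vimage_algebra (space M) X N)" "d \<in> A" "X \<in> space M \<rightarrow> space N"
  shows "X \<in> measurable (known A) N"
proof (rule measurableI)
  fix E assume "E \<in> sets N"
  then have "X -` E \<inter> space M \<in> draw_events d"
    unfolding assms(1) by (rule in_vimage_algebra)
  then show "X -` E \<inter> space (known A) \<in> sets (known A)"
    unfolding sets_known space_known using assms(2) by (blast intro: sigma_sets.Basic)
qed (use assms(3) in auto)

lemma seed_random_variable:
  assumes "i \<in> {1..n}"
  shows "\<xi> k i \<in> measurable M R" "distr M R (\<xi> k i) = R"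
  using draws assms unfolding random_draws_def by auto

lemma component_random_variable:
  assumes "i \<in> {1..n}"
  shows "J k i \<in> measurable M (count_space UNIV)"
    "distr M (count_space UNIV) (J k i) = measure_pmf (pmf_of_set {1..m})"
  using draws assms unfolding random_draws_def by auto

lemma measurable_output_index: "Output_Index \<in> A \<Longrightarrow> a \<in> measurable (known A) (count_space UNIV)"
  by (rule measurable_draw) (auto simp: draw_events_def)

lemma measurable_coin: "Coin k \<in> A \<Longrightarrow> u k \<in> measurable (known A) (count_space UNIV)"
  by (rule measurable_draw) (auto simp: draw_events_def)

lemma measurable_component: "Component k i \<in> A \<Longrightarrow> J k i \<in> measurable (known A) (count_space UNIV)"
  by (rule measurable_draw) (auto simp: draw_events_def)

lemma measurable_seed:
  assumes "i \<in> {1..n}" "Seed k i \<in> A"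
  shows "\<xi> k i \<in> measurable (known A) R"
proof (rule measurable_draw[OF _ assms(2)])
  show "\<xi> k i \<in> space M \<rightarrow> space R"
    using seed_random_variable(1)[OF assms(1)] by (auto dest: measurable_space)
qed (simp add: draw_events_def)

lemma component_average:
  fixes g :: "nat \<Rightarrow> 'v::euclidean_space"
  assumes "i \<in> {1..n}"
  shows "expectation (\<lambda>p. g (J k i p)) = (\<Sum>j\<in>{1..m}. g j) /\<^sub>R real m"
proof -
  note J = component_random_variable[OF assms, of k]
  have "expectation (\<lambda>p. g (J k i p)) = (\<integral>j. g j \<partial>measure_pmf (pmf_of_set {1..m}))"
    unfolding J(2)[symmetric] by (rule integral_distr[OF J(1), symmetric]) simp
  also have "\<dots> = (\<Sum>j\<in>{1..m}. g j) /\<^sub>R real m"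
    using m_pos by (subst integral_measure_pmf[of "{1..m}"]) (auto simp: scaleR_sum_right divide_inverse)
  finally show ?thesis .
qed

lemma component_in_range:
  assumes "i \<in> {1..n}"
  shows "AE p in M. J k i p \<in> {1..m}"
proof -
  note J = component_random_variable[OF assms, of k]
  have "AE j in distr M (count_space UNIV) (J k i). j \<in> {1..m}"
    unfolding J(2) using m_pos by (auto simp: AE_measure_pmf_iff)
  then show ?thesis
    by (subst (asm) AE_distr_iff[OF J(1)]) auto
qed

lemma coin_expectation:
  assumes "var = L_SVRG"
  shows "expectation (\<lambda>p. of_bool (u k p)) = 1 / real m"
proof -
  have U: "u k \<in> measurable M (count_space UNIV)"
    "distr M (count_space UNIV) (u k) = measure_pmf (bernoulli_pmf (1 / real m))"
    using draws assms unfolding random_draws_def by auto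
  have "expectation (\<lambda>p. of_bool (u k p)) = (\<integral>b. of_bool b \<partial>measure_pmf (bernoulli_pmf (1 / real m)) :: real)"
    unfolding U(2)[symmetric] by (rule integral_distr[OF U(1), symmetric]) simp
  also have "\<dots> = 1 / real m"
    using m_pos by (simp add: integral_bernoulli_pmf)
  finally show ?thesis .
qed

lemma seed_expectation:
  fixes g :: "'r \<Rightarrow> 'v::euclidean_space"
  assumes "i \<in> {1..n}" "integrable R g"
  shows "integrable M (\<lambda>p. g (\<xi> k i p))" "expectation (\<lambda>p. g (\<xi> k i p)) = (\<integral>r. g r \<partial>R)"
proof -
  note X = seed_random_variable[OF assms(1), of k]
  have g: "g \<in> borel_measurable R"
    using assms(2) by simp
  show "integrable M (\<lambda>p. g (\<xi> k i p))"
    using assms(2) integrable_distr_eq[OF X(1) g] X(2) by simp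
  show "expectation (\<lambda>p. g (\<xi> k i p)) = (\<integral>r. g r \<partial>R)"
    using integral_distr[OF X(1) g] X(2) by simp
qed

lemma output_index_probability:
  assumes "k < K"
  shows "(\<integral>\<^sup>+p. of_bool (a p = k) \<partial>M) = ennreal (1 / real K)"
proof -
  have A: "a \<in> measurable M (count_space UNIV)"
    "distr M (count_space UNIV) a = measure_pmf (pmf_of_set {0..<K})"
    using draws unfolding random_draws_def by auto
  have "(\<integral>\<^sup>+p. of_bool (a p = k) \<partial>M) = (\<integral>\<^sup>+p. indicator {k} (a p) \<partial>M)"
    by (intro nn_integral_cong) (auto simp: indicator_def)
  also have "\<dots> = (\<integral>\<^sup>+l. indicator {k} l \<partial>distr M (count_space UNIV) a)"
    by (rule nn_integral_distr[OF A(1), symmetric]) simp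
  also have "\<dots> = ennreal (1 / real K)"
    unfolding A(2) using assms K_pos by (simp add: emeasure_pmf_single)
  finally show ?thesis .
qed

lemma output_index_in_range: "AE p in M. a p < K"
proof -
  have A: "a \<in> measurable M (count_space UNIV)"
    "distr M (count_space UNIV) a = measure_pmf (pmf_of_set {0..<K})"
    using draws unfolding random_draws_def by auto
  have "AE l in distr M (count_space UNIV) a. l < K"
    unfolding A(2) using K_pos by (auto simp: AE_measure_pmf_iff)
  then show ?thesis
    by (subst (asm) AE_distr_iff[OF A(1)]) auto
qed

text \<open>
  On the event that \<open>j\<close> is sampled, what a worker does is a function of its seed alone, and the seed is
  independent of the sampling.
\<close>

lemma component_seed_expectation:
  fixes \<psi> :: "'r \<Rightarrow> 'v::euclidean_space"
  assumes i: "i \<in> {1..n}" and j: "j \<in> {1..m}" and \<psi>: "integrable R \<psi>"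
  shows "integrable M (\<lambda>p. of_bool (J k i p = j) *\<^sub>R \<psi> (\<xi> k i p))"
    and "expectation (\<lambda>p. of_bool (J k i p = j) *\<^sub>R \<psi> (\<xi> k i p)) = (\<integral>r. \<psi> r \<partial>R) /\<^sub>R real m"
proof -
  have indep: "indep_set (sets (known {Component k i})) (sets (known {Seed k i}))"
    using i by (intro indep_known) (auto simp: draws_def)
  have [measurable]: "J k i \<in> measurable (known {Component k i}) (count_space UNIV)"
    by (rule measurable_component) simp
  have X: "(\<lambda>p. of_bool (J k i p = j) :: real) \<in> borel_measurable (known {Component k i})"
    by measurable
  have "(\<lambda>p. of_bool (J k i p = j) :: real) \<in> borel_measurable M"
    using i by (intro measurable_knownI[OF _ X]) (auto simp: draws_def)
  then have Xint: "integrable M (\<lambda>p. of_bool (J k i p = j) :: real)"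
    by (rule integrable_const_bound[where B=1, rotated]) auto
  have Y: "(\<lambda>p. \<psi> (\<xi> k i p)) \<in> borel_measurable (known {Seed k i})"
    by (rule measurable_compose[OF measurable_seed]) (use i \<psi> in auto)
  note * = indep_set_expectation_scaleR[OF indep space_known space_known X Xint Y seed_expectation(1)[OF i \<psi>]]
  show "integrable M (\<lambda>p. of_bool (J k i p = j) *\<^sub>R \<psi> (\<xi> k i p))"
    by (rule *(1))
  have "(\<Sum>l\<in>{1..m}. of_bool (l = j) :: real) = 1"
    using j by (simp add: of_bool_def)
  then show "expectation (\<lambda>p. of_bool (J k i p = j) *\<^sub>R \<psi> (\<xi> k i p)) = (\<integral>r. \<psi> r \<partial>R) /\<^sub>R real m"
    using component_average[OF i, where k=k and g="\<lambda>l. of_bool (l = j) :: real"]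
    by (simp add: *(2) seed_expectation(2)[OF i \<psi>] divide_inverse)
qed

text \<open>
  The law of total expectation over the sampled component, which almost surely lies in \<open>{1..m}\<close>.
\<close>

lemma worker_expectation:
  fixes \<psi> :: "nat \<Rightarrow> 'r \<Rightarrow> 'v::euclidean_space"
  assumes i: "i \<in> {1..n}" and \<psi>: "\<And>j. integrable R (\<psi> j)"
  shows "integrable M (\<lambda>p. \<psi> (J k i p) (\<xi> k i p))"
    and "expectation (\<lambda>p. \<psi> (J k i p) (\<xi> k i p)) = (\<Sum>j\<in>{1..m}. \<integral>r. \<psi> j r \<partial>R) /\<^sub>R real m"
proof -
  let ?S = "\<lambda>p. \<Sum>j\<in>{1..m}. of_bool (J k i p = j) *\<^sub>R \<psi> j (\<xi> k i p)"
  have sub: "{Component k i, Seed k i} \<subseteq> draws var n"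
    using i by (auto simp: draws_def)
  have J: "J k i \<in> measurable M (count_space UNIV)"
    by (rule measurable_knownI[OF sub measurable_component]) simp
  have meas: "(\<lambda>p. \<psi> (J k i p) (\<xi> k i p)) \<in> borel_measurable M"
    by (rule measurable_compose_countable[OF _ J, where f="\<lambda>j p. \<psi> j (\<xi> k i p)"])
      (use seed_expectation(1)[OF i \<psi>] in simp)
  have ae: "AE p in M. \<psi> (J k i p) (\<xi> k i p) = ?S p"
    using component_in_range[OF i, of k]
  proof eventually_elim
    case (elim p)
    have "?S p = (\<Sum>j\<in>{1..m}. if j = J k i p then \<psi> j (\<xi> k i p) else 0)"
      by (intro sum.cong) auto
    with elim show ?case
      by simp
  qed
  have int: "integrable M ?S"
    by (intro Bochner_Integration.integrable_sum component_seed_expectation(1) i \<psi>)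
  show "integrable M (\<lambda>p. \<psi> (J k i p) (\<xi> k i p))"
    using int meas ae by (subst integrable_cong_AE[where g="?S"]) auto
  have "expectation (\<lambda>p. \<psi> (J k i p) (\<xi> k i p)) = expectation ?S"
    using int meas ae by (intro integral_cong_AE) auto
  also have "\<dots> = (\<Sum>j\<in>{1..m}. (\<integral>r. \<psi> j r \<partial>R) /\<^sub>R real m)"
    by (subst Bochner_Integration.integral_sum)
      (auto intro!: component_seed_expectation i \<psi> sum.cong)
  finally show "expectation (\<lambda>p. \<psi> (J k i p) (\<xi> k i p)) = (\<Sum>j\<in>{1..m}. \<integral>r. \<psi> j r \<partial>R) /\<^sub>R real m"
    by (simp add: scaleR_sum_right)
qed

end

section \<open>Quadratic inequalities\<close>

lemma two_inner_le:
  fixes a b :: "'v::real_inner"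
  assumes "c > 0"
  shows "2 * (a \<bullet> b) \<le> c * (norm a)\<^sup>2 + (norm b)\<^sup>2 / c"
proof -
  have "0 \<le> (norm (c *\<^sub>R a - b))\<^sup>2"
    by simp
  also have "\<dots> = c * (c * (norm a)\<^sup>2 + (norm b)\<^sup>2 / c - 2 * (a \<bullet> b))"
    using assms by (simp add: power2_norm_eq_inner inner_diff_left inner_diff_right inner_commute algebra_simps)
  finally show ?thesis
    using assms by (simp add: zero_le_mult_iff)
qed

lemma norm_add_sq_le:
  fixes a b :: "'v::real_inner"
  assumes "c > 0"
  shows "(norm (a + b))\<^sup>2 \<le> (1 + c) * (norm a)\<^sup>2 + (1 + 1 / c) * (norm b)\<^sup>2"
  using two_inner_le[OF assms, of a b]
  by (simp add: power2_norm_eq_inner inner_add_left inner_add_right inner_commute algebra_simps)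

lemma norm_add_scaleR_sq:
  fixes v b :: "'v::real_inner"
  shows "(norm (v + c *\<^sub>R b))\<^sup>2 = (norm v)\<^sup>2 + 2 * c * (b \<bullet> v) + c\<^sup>2 * (norm b)\<^sup>2"
  unfolding power2_norm_eq_inner
  by (simp add: inner_add_left inner_add_right inner_commute power2_eq_square)

text \<open>
  The mean minimizes the mean squared distance, and the defect is explicit. The case \<open>c = 0\<close> bounds a
  variance by a second moment; \<open>c = h\<^sub>i\<close> splits the size of what a worker transmits into its variance
  and the error of the shift.
\<close>

lemma average_bias_variance:
  fixes y :: "'i \<Rightarrow> 'v::real_inner"
  assumes "finite A" "A \<noteq> {}" and mean: "(\<Sum>j\<in>A. y j) /\<^sub>R card A = \<mu>"
  shows "(\<Sum>j\<in>A. (norm (y j - c))\<^sup>2) / card A = (\<Sum>j\<in>A. (norm (y j - \<mu>))\<^sup>2) / card A + (norm (\<mu> - c))\<^sup>2"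
proof -
  have card: "real (card A) > 0"
    using assms by (simp add: card_gt_0_iff)
  have sum: "(\<Sum>j\<in>A. y j) = real (card A) *\<^sub>R \<mu>"
    using card mean by auto
  have "(norm (y j - c))\<^sup>2 = (norm (y j - \<mu>))\<^sup>2 + 2 * ((y j - \<mu>) \<bullet> (\<mu> - c)) + (norm (\<mu> - c))\<^sup>2" for j
    by (simp add: power2_norm_eq_inner inner_diff_left inner_diff_right inner_commute)
  then have "(\<Sum>j\<in>A. (norm (y j - c))\<^sup>2) = (\<Sum>j\<in>A. (norm (y j - \<mu>))\<^sup>2)
      + 2 * ((\<Sum>j\<in>A. y j - \<mu>) \<bullet> (\<mu> - c)) + real (card A) * (norm (\<mu> - c))\<^sup>2"
    by (simp add: sum.distrib inner_sum_left sum_distrib_left)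
  also have "(\<Sum>j\<in>A. y j - \<mu>) = 0"
    by (simp add: sum_subtractf sum scaleR_conv_of_real sum_constant_scaleR)
  finally show ?thesis
    using card by (simp add: field_simps)
qed

section \<open>Finite sums of smooth functions\<close>

locale smooth_finite_sum =
  fixes n m :: nat and f :: "nat \<Rightarrow> nat \<Rightarrow> 'v::euclidean_space \<Rightarrow> real" and L :: real
  assumes n_ge: "n \<ge> 1" and m_ge: "m \<ge> 1" and L_pos: "L > 0"
    and smooth: "\<And>i j. i \<in> {1..n} \<Longrightarrow> j \<in> {1..m} \<Longrightarrow> L_smooth L (f i j)"
    and lipschitz: "\<And>i j. i \<in> {1..n} \<Longrightarrow> j \<in> {1..m} \<Longrightarrow> L-lipschitz_on UNIV (gradient (f i j))"
begin

abbreviation worker_grad :: "nat \<Rightarrow> 'v \<Rightarrow> 'v" where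
  "worker_grad i \<equiv> gradient (worker_obj m f i)"

abbreviation full_grad :: "'v \<Rightarrow> 'v" where
  "full_grad \<equiv> gradient (objective n m f)"

lemma GDERIV_component: "i \<in> {1..n} \<Longrightarrow> j \<in> {1..m} \<Longrightarrow> GDERIV (f i j) x :> gradient (f i j) x"
  using smooth by (intro GDERIV_gradient) (auto simp: L_smooth_def)

lemma GDERIV_worker:
  "i \<in> {1..n} \<Longrightarrow> GDERIV (worker_obj m f i) x :> (\<Sum>j\<in>{1..m}. gradient (f i j) x) /\<^sub>R real m"
  unfolding worker_obj_def[abs_def] by (intro GDERIV_average GDERIV_component)

lemma worker_grad: "i \<in> {1..n} \<Longrightarrow> worker_grad i x = (\<Sum>j\<in>{1..m}. gradient (f i j) x) /\<^sub>R real m"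
  by (intro gradient_eqI GDERIV_worker)

lemma GDERIV_objective: "GDERIV (objective n m f) x :> (\<Sum>i\<in>{1..n}. worker_grad i x) /\<^sub>R real n"
  unfolding objective_def[abs_def] by (intro GDERIV_average) (use GDERIV_worker worker_grad in auto)

lemma full_grad: "full_grad x = (\<Sum>i\<in>{1..n}. worker_grad i x) /\<^sub>R real n"
  by (intro gradient_eqI GDERIV_objective)

lemma worker_grad_lipschitz:
  assumes i: "i \<in> {1..n}"
  shows "norm (worker_grad i x - worker_grad i y) \<le> L * norm (x - y)"
proof -
  have "norm (worker_grad i x - worker_grad i y) = norm (\<Sum>j\<in>{1..m}. gradient (f i j) x - gradient (f i j) y) / real m"
    by (simp add: worker_grad[OF i] scaleR_diff_right[symmetric] sum_subtractf divide_inverse mult.commute)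
  also have "\<dots> \<le> (\<Sum>j\<in>{1..m}. L * norm (x - y)) / real m"
    using lipschitz[OF i]
    by (intro divide_right_mono sum_norm_le) (auto simp: lipschitz_on_def dist_norm)
  also have "\<dots> = L * norm (x - y)"
    using m_ge by simp
  finally show ?thesis .
qed

lemma objective_smooth:
  "objective n m f y \<le> objective n m f x + full_grad x \<bullet> (y - x) + L / 2 * (norm (x - y))\<^sup>2"
proof -
  have worker: "worker_obj m f i y \<le> worker_obj m f i x + worker_grad i x \<bullet> (y - x) + L / 2 * (norm (x - y))\<^sup>2"
    if i: "i \<in> {1..n}" for i
  proof -
    have "(\<Sum>j\<in>{1..m}. f i j y) \<le> (\<Sum>j\<in>{1..m}. f i j x + gradient (f i j) x \<bullet> (y - x) + L / 2 * (norm (x - y))\<^sup>2)"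
      using smooth[OF i] by (intro sum_mono) (auto simp: L_smooth_def)
    then have "(\<Sum>j\<in>{1..m}. f i j y) / real m \<le>
        (\<Sum>j\<in>{1..m}. f i j x + gradient (f i j) x \<bullet> (y - x) + L / 2 * (norm (x - y))\<^sup>2) / real m"
      by (rule divide_right_mono) simp
    moreover have "worker_grad i x \<bullet> (y - x) = (\<Sum>j\<in>{1..m}. gradient (f i j) x \<bullet> (y - x)) / real m"
      by (simp add: worker_grad[OF i] inner_sum_left divide_inverse mult.commute)
    ultimately show ?thesis
      using m_ge by (simp add: worker_obj_def sum.distrib add_divide_distrib)
  qed
  have grad: "full_grad x \<bullet> (y - x) = (\<Sum>i\<in>{1..n}. worker_grad i x \<bullet> (y - x)) / real n"
    by (simp add: full_grad inner_sum_left divide_inverse mult.commute)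
  have "(\<Sum>i\<in>{1..n}. worker_obj m f i y) / real n \<le>
      (\<Sum>i\<in>{1..n}. worker_obj m f i x + worker_grad i x \<bullet> (y - x) + L / 2 * (norm (x - y))\<^sup>2) / real n"
    by (intro divide_right_mono sum_mono worker) auto
  then show ?thesis
    using n_ge by (simp add: objective_def grad sum.distrib add_divide_distrib)
qed

text \<open>
  The stochastic gradient of worker \<open>i\<close> if it samples component \<open>j\<close>.
\<close>

definition estimate :: "'v diana_state \<Rightarrow> nat \<Rightarrow> nat \<Rightarrow> 'v" where
  "estimate s i j = gradient (f i j) (iterate s) - gradient (f i j) (ref_pt s i j)
     + (1 / real m) *\<^sub>R (\<Sum>l\<in>{1..m}. gradient (f i l) (ref_pt s i l))"

definition ref_error :: "'v diana_state \<Rightarrow> nat \<Rightarrow> real" where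
  "ref_error s i = (\<Sum>j\<in>{1..m}. (norm (iterate s - ref_pt s i j))\<^sup>2) / real m"

lemma ref_error_nonneg: "ref_error s i \<ge> 0"
  by (simp add: ref_error_def sum_nonneg)

lemma estimate_mean:
  assumes "i \<in> {1..n}"
  shows "(\<Sum>j\<in>{1..m}. estimate s i j) /\<^sub>R real m = worker_grad i (iterate s)"
  using m_ge by (simp add: estimate_def worker_grad[OF assms] sum.distrib sum_subtractf
      scaleR_add_right scaleR_diff_right sum_constant_scaleR divide_inverse)

text \<open>
  Subtracting the stored gradient and adding the mean of the stored gradients leaves a centred version of
  \<open>\<nabla>f\<^sub>i\<^sub>j(x) - \<nabla>f\<^sub>i\<^sub>j(w\<^sub>i\<^sub>j)\<close>, which is small when the reference points are near \<open>x\<close>.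
\<close>

lemma estimate_variance:
  assumes i: "i \<in> {1..n}"
  shows "(\<Sum>j\<in>{1..m}. (norm (estimate s i j - worker_grad i (iterate s)))\<^sup>2) / real m \<le> L\<^sup>2 * ref_error s i"
proof -
  define y where "y j = gradient (f i j) (iterate s) - gradient (f i j) (ref_pt s i j)" for j
  define \<mu> where "\<mu> = (\<Sum>j\<in>{1..m}. y j) /\<^sub>R real m"
  have "estimate s i j - worker_grad i (iterate s) = y j - \<mu>" for j
    by (simp add: estimate_def worker_grad[OF i] y_def \<mu>_def sum_subtractf scaleR_diff_right divide_inverse)
  then have "(\<Sum>j\<in>{1..m}. (norm (estimate s i j - worker_grad i (iterate s)))\<^sup>2) / real m =
      (\<Sum>j\<in>{1..m}. (norm (y j - \<mu>))\<^sup>2) / real m"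
    by simp
  also have "\<dots> \<le> (\<Sum>j\<in>{1..m}. (norm (y j))\<^sup>2) / real m"
    using average_bias_variance[of "{1..m}" y \<mu> 0] m_ge by (simp add: \<mu>_def)
  also have "\<dots> \<le> (\<Sum>j\<in>{1..m}. L\<^sup>2 * (norm (iterate s - ref_pt s i j))\<^sup>2) / real m"
  proof (intro divide_right_mono sum_mono)
    fix j assume j: "j \<in> {1..m}"
    have "norm (y j) \<le> L * norm (iterate s - ref_pt s i j)"
      using lipschitz[OF i j] by (auto simp: y_def lipschitz_on_def dist_norm)
    then have "(norm (y j))\<^sup>2 \<le> (L * norm (iterate s - ref_pt s i j))\<^sup>2"
      by (rule power_mono) simp
    then show "(norm (y j))\<^sup>2 \<le> L\<^sup>2 * (norm (iterate s - ref_pt s i j))\<^sup>2"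
      by (simp add: power_mult_distrib)
  qed simp
  also have "\<dots> = L\<^sup>2 * ref_error s i"
    by (simp add: ref_error_def sum_distrib_left)
  finally show ?thesis .
qed

end

section \<open>Balancing the coefficients of the potential\<close>

text \<open>
  Here \<open>E\<close> is the second moment of the direction, \<open>g\<close> the squared norm of the full gradient, and \<open>H\<close>
  and \<open>W\<close> are the two errors; \<open>q\<close> stands for \<open>m\<^sup>2\<^sup>/\<^sup>3 + \<omega> + 1\<close> and \<open>s\<close> for \<open>(1 + \<omega>/n)\<^sup>1\<^sup>/\<^sup>2\<close>. The weight \<open>B\<close>
  is chosen to make the coefficient of \<open>H\<close> come out, \<open>a\<close> to make that of \<open>W\<close> come out. The step size enters through \<open>\<gamma> L s q = 1/10\<close>, which keeps the total
  weight \<open>S\<close> of \<open>E\<close> below \<open>L \<gamma>\<^sup>2\<close>. The condition \<open>q\<^sup>3 \<ge> m\<^sup>2\<close> pays for the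
  summand \<open>5/2 \<gamma>\<^sup>2 m g\<close>, which stems from the cross term in the error of the reference points; it is the
  reason for the exponent \<open>2/3\<close>.
\<close>

lemma lyapunov_coefficients:
  fixes m n L w q s \<gamma> \<alpha> a B g E H W :: real
  assumes m: "m \<ge> 1" and n: "n \<ge> 1" and L: "L > 0" and w: "w \<ge> 0"
    and q: "q \<ge> w + 1" "q\<^sup>2 \<ge> m" "q ^ 3 \<ge> m\<^sup>2"
    and s: "s \<ge> 1" "s\<^sup>2 = 1 + w / n"
    and \<gamma>: "\<gamma> > 0" "\<gamma> * L * s * q = 1 / 10" and \<alpha>: "\<alpha> = 1 / (w + 1)"
    and a: "a = m / (10 * q\<^sup>2)" and B: "B = 2 * \<gamma>\<^sup>2 * L * (w + 1) * (w / n)"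
    and g: "g \<ge> 0" and H: "H \<ge> 0" and W: "W \<ge> 0"
    and E: "E \<le> g + w / n * H + (w + 1) / n * L\<^sup>2 * W"
  shows "- \<gamma> * g + L / 2 * \<gamma>\<^sup>2 * E
      + a * L * (\<gamma>\<^sup>2 * E + (1 - 1 / m + 2 / (5 * m) + 2 * \<gamma> * L / (m * n)) * W + 5 / 2 * \<gamma>\<^sup>2 * m * g)
      + B * ((1 + \<alpha> / 2) * ((1 - \<alpha>) * H + \<alpha> * L\<^sup>2 * W) + (1 + 2 / \<alpha>) * L\<^sup>2 * \<gamma>\<^sup>2 * E)
    \<le> a * L * W + B * H - \<gamma> / 4 * g"
proof -
  have q1: "q \<ge> 1"
    using q w by simp
  have \<alpha>pos: "0 < \<alpha>" "\<alpha> \<le> 1"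
    using w by (auto simp: \<alpha>)
  have \<gamma>L: "\<gamma> * L \<le> 1 / 10" "\<gamma> * L > 0"
  proof -
    have "\<gamma> * L * (1 * 1) \<le> \<gamma> * L * (s * q)"
      using \<gamma> L s q1 by (intro mult_left_mono mult_mono) auto
    then show "\<gamma> * L \<le> 1 / 10"
      using \<gamma>(2) by (simp add: mult.assoc)
  qed (use \<gamma> L in simp)
  have sq: "(\<gamma> * L)\<^sup>2 * s\<^sup>2 * q\<^sup>2 = 1 / 100"
  proof -
    have "(\<gamma> * L)\<^sup>2 * s\<^sup>2 * q\<^sup>2 = (\<gamma> * L * s * q)\<^sup>2"
      by (simp add: power_mult_distrib)
    then show ?thesis
      unfolding \<gamma>(2) by (simp add: power2_eq_square)
  qed
  have B0: "B \<ge> 0" and a0: "a \<ge> 0"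
    using B \<gamma> L w n a m by auto
  have a1: "a \<le> 1 / 10"
    using q(2) q1 m by (simp add: a field_simps)
  have wn: "w / n \<ge> 0" "w / n \<le> s\<^sup>2" "1 / n + w / n \<le> s\<^sup>2"
    using w n s by auto
  define S where "S = L / 2 * \<gamma>\<^sup>2 + a * L * \<gamma>\<^sup>2 + B * (1 + 2 / \<alpha>) * L\<^sup>2 * \<gamma>\<^sup>2"
  have S: "S \<le> L * \<gamma>\<^sup>2" "S \<ge> 0"
  proof -
    have "(\<gamma> * L)\<^sup>2 * (w + 1)\<^sup>2 * (w / n) \<le> (\<gamma> * L)\<^sup>2 * q\<^sup>2 * s\<^sup>2"
      using w q wn \<gamma>(1) L
      by (intro mult_mono[OF mult_left_mono[OF power_mono] wn(2)] mult_nonneg_nonneg) auto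
    also have "\<dots> = (\<gamma> * L)\<^sup>2 * s\<^sup>2 * q\<^sup>2"
      by (simp only: mult_ac)
    finally have t: "(\<gamma> * L)\<^sup>2 * (w + 1)\<^sup>2 * (w / n) \<le> 1 / 100"
      unfolding sq .
    have "1 + 2 / \<alpha> \<le> 3 * (w + 1)"
      using w by (simp add: \<alpha>)
    then have "B * (1 + 2 / \<alpha>) * L\<^sup>2 * \<gamma>\<^sup>2 \<le> B * (3 * (w + 1)) * L\<^sup>2 * \<gamma>\<^sup>2"
      using B0 by (intro mult_right_mono mult_left_mono) auto
    also have "\<dots> = L * \<gamma>\<^sup>2 * (6 * ((\<gamma> * L)\<^sup>2 * (w + 1)\<^sup>2 * (w / n)))"
      by (simp add: B power_mult_distrib power2_eq_square)
    also have "\<dots> \<le> L * \<gamma>\<^sup>2 * (6 * (1 / 100))"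
      using t L by (intro mult_left_mono) auto
    finally have "B * (1 + 2 / \<alpha>) * L\<^sup>2 * \<gamma>\<^sup>2 \<le> 6 / 100 * (L * \<gamma>\<^sup>2)"
      by simp
    moreover have "a * (L * \<gamma>\<^sup>2) \<le> 1 / 10 * (L * \<gamma>\<^sup>2)"
      using a1 L by (intro mult_right_mono) auto
    moreover have "L * \<gamma>\<^sup>2 \<ge> 0"
      using L by simp
    moreover have "S = 1 / 2 * (L * \<gamma>\<^sup>2) + a * (L * \<gamma>\<^sup>2) + B * (1 + 2 / \<alpha>) * L\<^sup>2 * \<gamma>\<^sup>2"
      unfolding S_def by simp
    ultimately show "S \<le> L * \<gamma>\<^sup>2"
      by linarith
    show "S \<ge> 0"
      unfolding S_def using L a0 B0 \<alpha>pos by (intro add_nonneg_nonneg mult_nonneg_nonneg) auto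
  qed
  have "S * E \<le> S * (g + w / n * H + (w + 1) / n * L\<^sup>2 * W)"
    using E S by (intro mult_left_mono)
  also have "\<dots> \<le> L * \<gamma>\<^sup>2 * (g + w / n * H + (w + 1) / n * L\<^sup>2 * W)"
    using S g H W w n by (intro mult_right_mono) auto
  finally have SE: "S * E \<le> L * \<gamma>\<^sup>2 * g + L * \<gamma>\<^sup>2 * (w / n) * H + L * \<gamma>\<^sup>2 * L\<^sup>2 * ((w + 1) / n) * W"
    by (simp add: algebra_simps)
  have B\<alpha>: "B * \<alpha> = 2 * (\<gamma>\<^sup>2 * L * (w / n))"
  proof -
    have "B * \<alpha> = 2 * (\<gamma>\<^sup>2 * L * (w / n)) * ((w + 1) * \<alpha>)"
      by (simp only: B mult_ac)
    then show ?thesis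
      using w by (simp add: \<alpha>)
  qed
  \<comment> \<open>Half of the contraction of \<open>H\<close> pays for moving the iterate, the other half for the noise.\<close>
  have "B * ((1 + \<alpha> / 2) * (1 - \<alpha>)) + L * \<gamma>\<^sup>2 * (w / n) \<le> B"
  proof -
    have "B * ((1 + \<alpha> / 2) * (1 - \<alpha>)) = B - B * \<alpha> / 2 - B * \<alpha>\<^sup>2 / 2"
      by (simp add: power2_eq_square field_simps)
    moreover have "B * \<alpha>\<^sup>2 \<ge> 0"
      using B0 by simp
    ultimately show ?thesis
      using B\<alpha> by (simp add: mult_ac)
  qed
  then have cH: "(B * ((1 + \<alpha> / 2) * (1 - \<alpha>)) + L * \<gamma>\<^sup>2 * (w / n)) * H \<le> B * H"
    using H by (rule mult_right_mono)
  \<comment> \<open>Of the gain \<open>1/m\<close> in \<open>W\<close>, the cross term takes \<open>2/(5m)\<close> and the SAGA correlation at most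
     \<open>1/(5m)\<close>; the value of \<open>a\<close> makes the remaining \<open>2/(5m)\<close> match the noise.\<close>
  have "L * \<gamma>\<^sup>2 * L\<^sup>2 * ((w + 1) / n) + B * ((1 + \<alpha> / 2) * \<alpha>) * L\<^sup>2 \<le> 4 * (L * \<gamma>\<^sup>2 * L\<^sup>2 * s\<^sup>2)"
  proof -
    have "B * ((1 + \<alpha> / 2) * \<alpha>) * L\<^sup>2 = (B * \<alpha>) * L\<^sup>2 * (1 + \<alpha> / 2)"
      by simp
    also have "\<dots> \<le> (B * \<alpha>) * L\<^sup>2 * (3 / 2)"
      using B0 \<alpha>pos by (intro mult_left_mono) auto
    also have "\<dots> = 3 * (L * \<gamma>\<^sup>2 * L\<^sup>2 * (w / n))"
      by (simp add: B\<alpha>)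
    also have "\<dots> \<le> 3 * (L * \<gamma>\<^sup>2 * L\<^sup>2 * s\<^sup>2)"
      using wn L by (intro mult_left_mono) auto
    finally have "B * ((1 + \<alpha> / 2) * \<alpha>) * L\<^sup>2 \<le> 3 * (L * \<gamma>\<^sup>2 * L\<^sup>2 * s\<^sup>2)" .
    moreover have "L * \<gamma>\<^sup>2 * L\<^sup>2 * ((w + 1) / n) \<le> L * \<gamma>\<^sup>2 * L\<^sup>2 * s\<^sup>2"
      using wn(3) L by (intro mult_left_mono) (auto simp: add_divide_distrib)
    ultimately show ?thesis
      by simp
  qed
  also have "4 * (L * \<gamma>\<^sup>2 * L\<^sup>2 * s\<^sup>2) = L / (25 * q\<^sup>2)"
  proof -
    have "4 * (L * \<gamma>\<^sup>2 * L\<^sup>2 * s\<^sup>2) * q\<^sup>2 = 4 * L * ((\<gamma> * L)\<^sup>2 * s\<^sup>2 * q\<^sup>2)"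
      by (simp add: power_mult_distrib)
    then have "4 * (L * \<gamma>\<^sup>2 * L\<^sup>2 * s\<^sup>2) = 4 * L * (1 / 100) / q\<^sup>2"
      unfolding sq using q1 by (simp only: eq_divide_eq) simp
    then show ?thesis
      by simp
  qed
  also have "\<dots> = a * L * (2 / (5 * m))"
    using m q1 by (simp add: a field_simps)
  also have "\<dots> \<le> a * L * (1 / m - 2 / (5 * m) - 2 * \<gamma> * L / (m * n))"
  proof (intro mult_left_mono)
    have "2 * (\<gamma> * L) / (m * n) \<le> 2 * (1 / 10) / (m * 1)"
      using \<gamma>L m n by (intro frac_le mult_mono) auto
    then show "2 / (5 * m) \<le> 1 / m - 2 / (5 * m) - 2 * \<gamma> * L / (m * n)"
      using m by (simp add: field_simps)
  qed (use a0 L in auto)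
  finally have "(L * \<gamma>\<^sup>2 * L\<^sup>2 * ((w + 1) / n) + B * ((1 + \<alpha> / 2) * \<alpha>) * L\<^sup>2) * W
      \<le> a * L * (1 / m - 2 / (5 * m) - 2 * \<gamma> * L / (m * n)) * W"
    using W by (rule mult_right_mono)
  then have cW: "L * \<gamma>\<^sup>2 * L\<^sup>2 * ((w + 1) / n) * W + B * ((1 + \<alpha> / 2) * \<alpha>) * L\<^sup>2 * W
      + a * L * ((1 - 1 / m + 2 / (5 * m) + 2 * \<gamma> * L / (m * n)) * W) \<le> a * L * W"
    by (simp add: algebra_simps)
  \<comment> \<open>The noise uses at most \<open>1/10\<close> and the cross term at most \<open>1/40\<close> of the decrease \<open>\<gamma> g\<close>.\<close>
  have "L * \<gamma>\<^sup>2 + a * L * (5 / 2 * \<gamma>\<^sup>2 * m) \<le> 3 / 4 * \<gamma>"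
  proof -
    have "\<gamma> * L * m\<^sup>2 / (4 * q\<^sup>2) \<le> 1 / 40"
    proof -
      have "\<gamma> * L * m\<^sup>2 \<le> \<gamma> * L * (s * q ^ 3)"
      proof (rule mult_left_mono)
        have "1 * q ^ 3 \<le> s * q ^ 3"
          using s q1 by (intro mult_right_mono) auto
        then show "m\<^sup>2 \<le> s * q ^ 3"
          using q(3) by simp
      qed (use \<gamma>L in simp)
      also have "\<dots> = (\<gamma> * L * s * q) * q\<^sup>2"
        by (simp add: power3_eq_cube power2_eq_square)
      also have "\<dots> = 1 / 10 * q\<^sup>2"
        unfolding \<gamma>(2) ..
      finally show ?thesis
        using q1 by (simp add: field_simps)
    qed
    with \<gamma>L have "\<gamma> * L + \<gamma> * L * m\<^sup>2 / (4 * q\<^sup>2) \<le> 3 / 4"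
      by linarith
    then have "\<gamma> * (\<gamma> * L + \<gamma> * L * m\<^sup>2 / (4 * q\<^sup>2)) \<le> \<gamma> * (3 / 4)"
      using \<gamma>(1) by (intro mult_left_mono) auto
    moreover have "a * L * (5 / 2 * \<gamma>\<^sup>2 * m) = \<gamma> * (\<gamma> * L * m\<^sup>2 / (4 * q\<^sup>2))"
      by (simp add: a power2_eq_square)
    moreover have "L * \<gamma>\<^sup>2 = \<gamma> * (\<gamma> * L)"
      by (simp add: power2_eq_square)
    ultimately show ?thesis
      by (simp only: distrib_left mult.commute)
  qed
  then have cg: "(L * \<gamma>\<^sup>2 + a * L * (5 / 2 * \<gamma>\<^sup>2 * m)) * g \<le> 3 / 4 * \<gamma> * g"
    using g by (rule mult_right_mono)
  define c1 c2 c3 c4 where c: "c1 = 1 - 1 / m + 2 / (5 * m) + 2 * \<gamma> * L / (m * n)"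
    "c2 = 1 + 2 / \<alpha>" "c3 = 1 + \<alpha> / 2" "c4 = 1 - \<alpha>"
  have "- \<gamma> * g + L / 2 * \<gamma>\<^sup>2 * E
      + a * L * (\<gamma>\<^sup>2 * E + (1 - 1 / m + 2 / (5 * m) + 2 * \<gamma> * L / (m * n)) * W + 5 / 2 * \<gamma>\<^sup>2 * m * g)
      + B * ((1 + \<alpha> / 2) * ((1 - \<alpha>) * H + \<alpha> * L\<^sup>2 * W) + (1 + 2 / \<alpha>) * L\<^sup>2 * \<gamma>\<^sup>2 * E)
    = S * E - \<gamma> * g + a * L * (5 / 2 * \<gamma>\<^sup>2 * m) * g
      + a * L * ((1 - 1 / m + 2 / (5 * m) + 2 * \<gamma> * L / (m * n)) * W)
      + B * ((1 + \<alpha> / 2) * \<alpha>) * L\<^sup>2 * W + B * ((1 + \<alpha> / 2) * (1 - \<alpha>)) * H"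
    unfolding S_def c[symmetric] by (simp add: algebra_simps)
  also have "\<dots> \<le> a * L * W + B * H - \<gamma> / 4 * g"
    using SE cH cW cg unfolding c[symmetric] by (simp add: algebra_simps)
  finally show ?thesis .
qed

section \<open>One round from a fixed state\<close>

text \<open>
  An unbiased quantizer cannot decrease second moments; a unit vector shows it.
\<close>

lemma quantization_operator_omega_nonneg:
  fixes Q :: "'r \<Rightarrow> 'v::euclidean_space \<Rightarrow> 'v"
  assumes Q: "quantization_operator \<omega> R Q"
  shows "\<omega> \<ge> 0"
proof -
  interpret R: prob_space R
    using Q by (simp add: quantization_operator_def)
  obtain x :: 'v where x: "norm x = 1"
    using vector_choose_size[of 1] by auto
  have int: "integrable R (\<lambda>r. Q r x)" "(\<integral>r. Q r x \<partial>R) = x" "integrable R (\<lambda>r. (norm (Q r x))\<^sup>2)"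
    "(\<integral>r. (norm (Q r x))\<^sup>2 \<partial>R) \<le> (\<omega> + 1) * (norm x)\<^sup>2"
    using Q by (auto simp: quantization_operator_def)
  have "0 \<le> (\<integral>r. (norm (Q r x - x))\<^sup>2 \<partial>R)"
    by (rule integral_nonneg_AE) simp
  also have "(\<lambda>r. (norm (Q r x - x))\<^sup>2) = (\<lambda>r. (norm (Q r x))\<^sup>2 - 2 * (Q r x \<bullet> x) + (norm x)\<^sup>2)"
    by (simp add: power2_norm_eq_inner inner_diff_left inner_diff_right inner_commute algebra_simps)
  also have "(\<integral>r. (norm (Q r x))\<^sup>2 - 2 * (Q r x \<bullet> x) + (norm x)\<^sup>2 \<partial>R) = (\<integral>r. (norm (Q r x))\<^sup>2 \<partial>R) - (norm x)\<^sup>2"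
    using int by (simp add: R.prob_space power2_norm_eq_inner)
  also have "\<dots> \<le> \<omega>"
    using int(4) x by simp
  finally show ?thesis .
qed

locale vr_diana_run = diana_draws M var n m R K u J \<xi> a + smooth_finite_sum n m f L
  for M :: "'p measure" and var n m and R :: "'r measure" and K u J \<xi> a
    and f :: "nat \<Rightarrow> nat \<Rightarrow> 'v::euclidean_space \<Rightarrow> real" and L +
  fixes Q :: "'r \<Rightarrow> 'v \<Rightarrow> 'v" and \<omega> \<alpha> \<gamma> :: real
  assumes quantizer: "quantization_operator \<omega> R Q"
    and \<alpha>: "\<alpha> = 1 / (\<omega> + 1)"
    and \<gamma>: "\<gamma> = 1 / (10 * L * sqrt (1 + \<omega> / real n) * (real m powr (2 / 3) + \<omega> + 1))"
begin

lemma \<omega>_nonneg: "\<omega> \<ge> 0"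
  by (rule quantization_operator_omega_nonneg[OF quantizer])

lemma \<alpha>_pos: "\<alpha> > 0"
  using \<omega>_nonneg by (simp add: \<alpha>)

lemma \<gamma>_pos: "\<gamma> > 0"
proof -
  have "sqrt (1 + \<omega> / real n) > 0"
    using \<omega>_nonneg by (intro real_sqrt_gt_zero add_pos_nonneg) auto
  moreover have "real m powr (2 / 3) + \<omega> + 1 > 0"
    using \<omega>_nonneg by (intro add_nonneg_pos add_nonneg_nonneg) auto
  ultimately show ?thesis
    using L_pos by (simp add: \<gamma>)
qed

lemma Q_measurable: "(\<lambda>(r, x). Q r x) \<in> borel_measurable (R \<Otimes>\<^sub>M borel)"
  and Q_unbiased: "integrable R (\<lambda>r. Q r x)" "(\<integral>r. Q r x \<partial>R) = x"
  and Q_second_moment: "integrable R (\<lambda>r. (norm (Q r x))\<^sup>2)"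
    "(\<integral>r. (norm (Q r x))\<^sup>2 \<partial>R) \<le> (\<omega> + 1) * (norm x)\<^sup>2"
  using quantizer by (auto simp: quantization_operator_def)

definition step :: "nat \<Rightarrow> 'v diana_state \<Rightarrow> 'p \<Rightarrow> 'v diana_state" where
  "step k s p = diana_step var \<alpha> \<gamma> n m f Q (u k p) (\<lambda>i. J k i p) (\<lambda>i. \<xi> k i p) s"

definition message :: "nat \<Rightarrow> 'v diana_state \<Rightarrow> nat \<Rightarrow> 'p \<Rightarrow> 'v" where
  "message k s i p = Q (\<xi> k i p) (estimate s i (J k i p) - shift s i)"

definition direction :: "nat \<Rightarrow> 'v diana_state \<Rightarrow> 'p \<Rightarrow> 'v" where
  "direction k s p = (1 / real n) *\<^sub>R (\<Sum>i\<in>{1..n}. message k s i p + shift s i)"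

definition refreshed :: "nat \<Rightarrow> nat \<Rightarrow> nat \<Rightarrow> 'p \<Rightarrow> bool" where
  "refreshed k i j p = (case var of L_SVRG \<Rightarrow> u k p | SAGA \<Rightarrow> j = J k i p)"

lemma iterate_step: "iterate (step k s p) = iterate s - \<gamma> *\<^sub>R direction k s p"
  and shift_step: "shift (step k s p) i = shift s i + \<alpha> *\<^sub>R message k s i p"
  and ref_pt_step: "ref_pt (step k s p) i j = (if refreshed k i j p then iterate s else ref_pt s i j)"
  by (simp_all add: step_def diana_step_def Let_def direction_def message_def refreshed_def estimate_def)

definition worker_draws :: "nat \<Rightarrow> nat \<Rightarrow> draw set" where
  "worker_draws k i = {Component k i, Seed k i}"

lemma worker_draws_subset: "i \<in> {1..n} \<Longrightarrow> worker_draws k i \<subseteq> draws var n"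
  by (auto simp: worker_draws_def draws_def)

lemma measurable_message:
  assumes i: "i \<in> {1..n}"
  shows "message k s i \<in> borel_measurable (known (worker_draws k i))"
proof -
  have J: "J k i \<in> measurable (known (worker_draws k i)) (count_space UNIV)"
    by (rule measurable_component) (simp add: worker_draws_def)
  have \<xi>: "\<xi> k i \<in> measurable (known (worker_draws k i)) R"
    by (rule measurable_seed[OF i]) (simp add: worker_draws_def)
  have "(\<lambda>p. estimate s i (J k i p) - shift s i) \<in> borel_measurable (known (worker_draws k i))"
    by (rule measurable_compose[OF J]) simp
  from measurable_compose[OF measurable_Pair[OF \<xi> this] Q_measurable] show ?thesis
    by (simp add: message_def[abs_def])
qed

lemma message_expectation:
  assumes i: "i \<in> {1..n}"
  shows "integrable M (message k s i)"
    and "expectation (message k s i) = worker_grad i (iterate s) - shift s i"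
proof -
  note * = worker_expectation[OF i, where k=k and \<psi>="\<lambda>j r. Q r (estimate s i j - shift s i)",
      OF Q_unbiased(1), folded message_def]
  show "integrable M (message k s i)"
    using *(1) by simp
  show "expectation (message k s i) = worker_grad i (iterate s) - shift s i"
    using *(2) m_pos estimate_mean[OF i, of s]
    by (simp add: Q_unbiased(2) sum_subtractf scaleR_diff_right sum_constant_scaleR)
qed

text \<open>
  The quantizer inflates the second moment of \<open>g\<^sub>i - h\<^sub>i\<close> by \<open>\<omega> + 1\<close>, and that second moment is the variance
  of \<open>g\<^sub>i\<close> plus the squared distance of its mean from \<open>h\<^sub>i\<close>.
\<close>

lemma message_second_moment:
  assumes i: "i \<in> {1..n}"
  shows "integrable M (\<lambda>p. (norm (message k s i p))\<^sup>2)"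
    and "expectation (\<lambda>p. (norm (message k s i p))\<^sup>2)
      \<le> (\<omega> + 1) * ((norm (shift s i - worker_grad i (iterate s)))\<^sup>2 + L\<^sup>2 * ref_error s i)"
proof -
  note * = worker_expectation[OF i, where k=k and \<psi>="\<lambda>j r. (norm (Q r (estimate s i j - shift s i)))\<^sup>2",
      OF Q_second_moment(1), folded message_def]
  show "integrable M (\<lambda>p. (norm (message k s i p))\<^sup>2)"
    using *(1) by simp
  have "expectation (\<lambda>p. (norm (message k s i p))\<^sup>2) =
      (\<Sum>j\<in>{1..m}. \<integral>r. (norm (Q r (estimate s i j - shift s i)))\<^sup>2 \<partial>R) / real m"
    using *(2) by (simp add: divide_inverse)
  also have "\<dots> \<le> (\<Sum>j\<in>{1..m}. (\<omega> + 1) * (norm (estimate s i j - shift s i))\<^sup>2) / real m"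
    by (intro divide_right_mono sum_mono Q_second_moment) simp
  also have "\<dots> = (\<omega> + 1) * ((\<Sum>j\<in>{1..m}. (norm (estimate s i j - shift s i))\<^sup>2) / real m)"
    by (simp add: sum_distrib_left)
  also have "(\<Sum>j\<in>{1..m}. (norm (estimate s i j - shift s i))\<^sup>2) / real m =
      (\<Sum>j\<in>{1..m}. (norm (estimate s i j - worker_grad i (iterate s)))\<^sup>2) / real m
      + (norm (worker_grad i (iterate s) - shift s i))\<^sup>2"
    using average_bias_variance[of "{1..m}" "estimate s i" "worker_grad i (iterate s)" "shift s i"]
      estimate_mean[OF i, of s] m_pos by simp
  also have "(\<omega> + 1) * \<dots> \<le> (\<omega> + 1) * (L\<^sup>2 * ref_error s i + (norm (worker_grad i (iterate s) - shift s i))\<^sup>2)"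
    using estimate_variance[OF i, of s] \<omega>_nonneg by (intro mult_left_mono add_right_mono) auto
  finally show "expectation (\<lambda>p. (norm (message k s i p))\<^sup>2)
      \<le> (\<omega> + 1) * ((norm (shift s i - worker_grad i (iterate s)))\<^sup>2 + L\<^sup>2 * ref_error s i)"
    by (simp add: norm_minus_commute add.commute)
qed

definition shift_error :: "'v diana_state \<Rightarrow> nat \<Rightarrow> real" where
  "shift_error s i = (norm (shift s i - worker_grad i (iterate s)))\<^sup>2"

definition mean_ref_error :: "'v diana_state \<Rightarrow> real" where
  "mean_ref_error s = (\<Sum>i\<in>{1..n}. ref_error s i) / real n"

definition mean_shift_error :: "'v diana_state \<Rightarrow> real" where
  "mean_shift_error s = (\<Sum>i\<in>{1..n}. shift_error s i) / real n"

lemma direction_expectation: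
  "integrable M (direction k s)" "expectation (direction k s) = full_grad (iterate s)"
proof -
  have eq: "direction k s = (\<lambda>p. (1 / real n) *\<^sub>R (\<Sum>i\<in>{1..n}. message k s i p + shift s i))"
    by (rule ext) (rule direction_def)
  have int: "integrable M (\<lambda>p. message k s i p + shift s i)"
    "expectation (\<lambda>p. message k s i p + shift s i) = worker_grad i (iterate s)" if "i \<in> {1..n}" for i
    using message_expectation[OF that, of k s] by (auto simp: prob_space)
  show "integrable M (direction k s)"
    unfolding eq by (intro integrable_scaleR_right Bochner_Integration.integrable_sum int)
  have "expectation (direction k s) = (1 / real n) *\<^sub>R (\<Sum>i\<in>{1..n}. expectation (\<lambda>p. message k s i p + shift s i))"
    unfolding eq using int(1) by (simp add: Bochner_Integration.integral_sum)
  also have "\<dots> = full_grad (iterate s)"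
    using int(2) by (simp add: full_grad divide_inverse)
  finally show "expectation (direction k s) = full_grad (iterate s)" .
qed

text \<open>
  The centred messages \<open>Z\<^sub>i\<close> of different workers are uncorrelated, so the variance of the direction is
  \<open>1/n\<^sup>2\<close> times the sum of their variances.
\<close>

lemma direction_second_moment:
  "integrable M (\<lambda>p. (norm (direction k s p))\<^sup>2)"
  "expectation (\<lambda>p. (norm (direction k s p))\<^sup>2) \<le> (norm (full_grad (iterate s)))\<^sup>2
     + \<omega> / real n * mean_shift_error s + (\<omega> + 1) / real n * L\<^sup>2 * mean_ref_error s"
proof -
  define Z where "Z i p = message k s i p - (worker_grad i (iterate s) - shift s i)" for i p
  have Zint: "integrable M (Z i)" "expectation (Z i) = 0" if "i \<in> {1..n}" for i
    using message_expectation[OF that, of k s] by (auto simp: Z_def[abs_def] prob_space)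
  have Zmeas: "Z i \<in> borel_measurable (known (worker_draws k i))" if "i \<in> {1..n}" for i
    using measurable_message[OF that, of k s] by (simp add: Z_def[abs_def])
  have Zeq: "(\<lambda>p. (norm (Z i p))\<^sup>2) = (\<lambda>p. (norm (message k s i p))\<^sup>2
      - 2 * (message k s i p \<bullet> (worker_grad i (iterate s) - shift s i)) + shift_error s i)" for i
    by (simp add: Z_def shift_error_def norm_minus_commute[of "shift s i"] power2_norm_eq_inner
        inner_diff_left inner_diff_right inner_commute algebra_simps)
  have Zsq: "integrable M (\<lambda>p. (norm (Z i p))\<^sup>2)"
    "expectation (\<lambda>p. (norm (Z i p))\<^sup>2) \<le> \<omega> * shift_error s i + (\<omega> + 1) * (L\<^sup>2 * ref_error s i)"
    if i: "i \<in> {1..n}" for i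
  proof -
    note int = message_expectation[OF i, of k s] message_second_moment[OF i, of k s]
    show "integrable M (\<lambda>p. (norm (Z i p))\<^sup>2)"
      unfolding Zeq using int by simp
    have "expectation (\<lambda>p. (norm (Z i p))\<^sup>2) = expectation (\<lambda>p. (norm (message k s i p))\<^sup>2) - shift_error s i"
      unfolding Zeq using int
      by (simp add: prob_space shift_error_def norm_minus_commute[of "shift s i"] power2_norm_eq_inner)
    with int(4) show "expectation (\<lambda>p. (norm (Z i p))\<^sup>2) \<le> \<omega> * shift_error s i + (\<omega> + 1) * (L\<^sup>2 * ref_error s i)"
      by (simp add: shift_error_def algebra_simps)
  qed
  have cross: "integrable M (\<lambda>p. Z i p \<bullet> Z j p)" "expectation (\<lambda>p. Z i p \<bullet> Z j p) = 0"
    if "i \<in> {1..n}" "j \<in> {1..n}" "i \<noteq> j" for i j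
  proof -
    have indep: "indep_set (sets (known (worker_draws k i))) (sets (known (worker_draws k j)))"
      using that by (intro indep_known worker_draws_subset) (auto simp: worker_draws_def)
    note * = indep_set_imp_uncorrelated[OF indep space_known space_known
        Zmeas[OF that(1)] Zint(1)[OF that(1)] Zmeas[OF that(2)] Zint(1)[OF that(2)]]
    show "integrable M (\<lambda>p. Z i p \<bullet> Z j p)" "expectation (\<lambda>p. Z i p \<bullet> Z j p) = 0"
      using * Zint(2)[OF that(1)] by auto
  qed
  note sumZ = expectation_norm_sum_sq[of "{1..n}" M Z, OF Zsq(1) cross finite_atLeastAtMost]
  let ?g = "full_grad (iterate s)"
  have dir: "direction k s p = ?g + (1 / real n) *\<^sub>R (\<Sum>i\<in>{1..n}. Z i p)" for p
  proof -
    have "(\<Sum>i\<in>{1..n}. message k s i p + shift s i) = (\<Sum>i\<in>{1..n}. worker_grad i (iterate s)) + (\<Sum>i\<in>{1..n}. Z i p)"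
      by (simp add: Z_def sum.distrib[symmetric])
    then show ?thesis
      by (simp add: direction_def full_grad scaleR_add_right divide_inverse)
  qed
  have deq: "(\<lambda>p. (norm (direction k s p))\<^sup>2) = (\<lambda>p. (norm ?g)\<^sup>2
      + 2 / real n * (\<Sum>i\<in>{1..n}. Z i p \<bullet> ?g) + (1 / real n)\<^sup>2 * (norm (\<Sum>i\<in>{1..n}. Z i p))\<^sup>2)"
    by (intro ext) (simp add: dir norm_add_scaleR_sq inner_sum_left)
  have lin: "integrable M (\<lambda>p. \<Sum>i\<in>{1..n}. Z i p \<bullet> ?g)" "expectation (\<lambda>p. \<Sum>i\<in>{1..n}. Z i p \<bullet> ?g) = 0"
  proof -
    have "integrable M (\<lambda>p. Z i p \<bullet> ?g)" "expectation (\<lambda>p. Z i p \<bullet> ?g) = 0" if "i \<in> {1..n}" for i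
      using Zint[OF that] by auto
    then show "integrable M (\<lambda>p. \<Sum>i\<in>{1..n}. Z i p \<bullet> ?g)" "expectation (\<lambda>p. \<Sum>i\<in>{1..n}. Z i p \<bullet> ?g) = 0"
      by (auto simp: Bochner_Integration.integral_sum intro!: Bochner_Integration.integrable_sum)
  qed
  show "integrable M (\<lambda>p. (norm (direction k s p))\<^sup>2)"
    unfolding deq using lin sumZ by (intro Bochner_Integration.integrable_add integrable_mult_right) auto
  have "expectation (\<lambda>p. (norm (direction k s p))\<^sup>2) =
      (norm ?g)\<^sup>2 + (1 / real n)\<^sup>2 * (\<Sum>i\<in>{1..n}. expectation (\<lambda>p. (norm (Z i p))\<^sup>2))"
    unfolding deq using lin sumZ by (simp add: prob_space)
  also have "\<dots> \<le> (norm ?g)\<^sup>2 + (1 / real n)\<^sup>2 * (\<Sum>i\<in>{1..n}. \<omega> * shift_error s i + (\<omega> + 1) * (L\<^sup>2 * ref_error s i))"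
    by (intro add_left_mono mult_left_mono sum_mono Zsq(2)) auto
  also have "\<dots> = (norm ?g)\<^sup>2 + \<omega> / real n * mean_shift_error s + (\<omega> + 1) / real n * L\<^sup>2 * mean_ref_error s"
    by (simp add: mean_shift_error_def mean_ref_error_def sum.distrib sum_distrib_left[symmetric] power2_eq_square algebra_simps add_divide_distrib)
  finally show "expectation (\<lambda>p. (norm (direction k s p))\<^sup>2) \<le> (norm ?g)\<^sup>2
     + \<omega> / real n * mean_shift_error s + (\<omega> + 1) / real n * L\<^sup>2 * mean_ref_error s" .
qed

text \<open>
  Up to the factor \<open>1/m\<close>, the covariance between the message of worker \<open>i\<close> and the event that the reference
  point \<open>w\<^sub>i\<^sub>j\<close> is refreshed. It is what distinguishes SAGA from L-SVRG in this proof.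
\<close>

definition bias :: "'v diana_state \<Rightarrow> nat \<Rightarrow> nat \<Rightarrow> 'v" where
  "bias s i j = (case var of L_SVRG \<Rightarrow> 0 | SAGA \<Rightarrow> estimate s i j - worker_grad i (iterate s))"

lemma refreshed_cases:
  "var = L_SVRG \<Longrightarrow> refreshed k i j p \<longleftrightarrow> u k p"
  "var = SAGA \<Longrightarrow> refreshed k i j p \<longleftrightarrow> j = J k i p"
  unfolding refreshed_def by simp_all

lemma bias_cases:
  "var = L_SVRG \<Longrightarrow> bias s i j = 0"
  "var = SAGA \<Longrightarrow> bias s i j = estimate s i j - worker_grad i (iterate s)"
  unfolding bias_def by simp_all

lemma refreshed_probability:
  assumes i: "i \<in> {1..n}" and j: "j \<in> {1..m}"
  shows "integrable M (\<lambda>p. of_bool (refreshed k i j p) :: real)"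
    and "expectation (\<lambda>p. of_bool (refreshed k i j p)) = 1 / real m"
proof -
  have meas: "(\<lambda>p. of_bool (refreshed k i j p) :: real) \<in> borel_measurable M"
  proof (cases var)
    case L_SVRG
    have [measurable]: "u k \<in> measurable M (count_space UNIV)"
      using L_SVRG by (intro measurable_knownI[OF _ measurable_coin[of k "{Coin k}"]]) (auto simp: draws_def)
    show ?thesis
      by (simp add: refreshed_cases(1)[OF L_SVRG])
  next
    case SAGA
    have [measurable]: "J k i \<in> measurable M (count_space UNIV)"
      by (rule component_random_variable[OF i])
    show ?thesis
      by (simp add: refreshed_cases(2)[OF SAGA])
  qed
  then show "integrable M (\<lambda>p. of_bool (refreshed k i j p) :: real)"
    by (rule integrable_const_bound[where B=1, rotated]) auto
  show "expectation (\<lambda>p. of_bool (refreshed k i j p)) = 1 / real m"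
  proof (cases var)
    case L_SVRG
    show ?thesis
      using coin_expectation[OF L_SVRG, of k] by (simp add: refreshed_cases(1)[OF L_SVRG])
  next
    case SAGA
    have "(\<Sum>l\<in>{1..m}. of_bool (j = l) :: real) = 1"
      using j by (simp add: of_bool_def)
    then show ?thesis
      using component_average[OF i, where k=k and g="\<lambda>l. of_bool (j = l) :: real"]
      by (simp add: refreshed_cases(2)[OF SAGA] divide_inverse)
  qed
qed

text \<open>
  The refreshing event is independent of the message of worker \<open>l\<close> under L-SVRG, and under SAGA unless
  \<open>l = i\<close>. In the remaining case the event says that worker \<open>i\<close> has sampled \<open>j\<close>, and then the mean of its
  message is known.
\<close>

lemma refreshed_message:
  assumes i: "i \<in> {1..n}" and j: "j \<in> {1..m}" and l: "l \<in> {1..n}"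
  shows "integrable M (\<lambda>p. of_bool (refreshed k i j p) *\<^sub>R message k s l p)"
    and "expectation (\<lambda>p. of_bool (refreshed k i j p) *\<^sub>R message k s l p) =
      (worker_grad l (iterate s) - shift s l + (if l = i then bias s i j else 0)) /\<^sub>R real m"
proof -
  let ?goal = "integrable M (\<lambda>p. of_bool (refreshed k i j p) *\<^sub>R message k s l p) \<and>
    expectation (\<lambda>p. of_bool (refreshed k i j p) *\<^sub>R message k s l p) =
      (worker_grad l (iterate s) - shift s l + (if l = i then bias s i j else 0)) /\<^sub>R real m"
  have uncorrelated: "integrable M (\<lambda>p. of_bool (refreshed k i j p) *\<^sub>R message k s l p) \<and>
      expectation (\<lambda>p. of_bool (refreshed k i j p) *\<^sub>R message k s l p) =
      (worker_grad l (iterate s) - shift s l) /\<^sub>R real m"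
    if "A \<subseteq> draws var n" "A \<inter> worker_draws k l = {}"
      and meas: "(\<lambda>p. of_bool (refreshed k i j p) :: real) \<in> borel_measurable (known A)" for A
  proof -
    have indep: "indep_set (sets (known A)) (sets (known (worker_draws k l)))"
      using that(1,2) by (intro indep_known worker_draws_subset l)
    show ?thesis
      using indep_set_expectation_scaleR[OF indep space_known space_known meas
          refreshed_probability(1)[OF i j] measurable_message[OF l] message_expectation(1)[OF l]]
      by (simp add: refreshed_probability(2)[OF i j] message_expectation(2)[OF l] divide_inverse)
  qed
  have ?goal
  proof (cases var)
    case L_SVRG
    have [measurable]: "u k \<in> measurable (known {Coin k}) (count_space UNIV)"
      by (rule measurable_coin) simp
    have "(\<lambda>p. of_bool (refreshed k i j p) :: real) \<in> borel_measurable (known {Coin k})"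
      by (simp add: refreshed_cases(1)[OF L_SVRG])
    moreover have "{Coin k} \<subseteq> draws var n"
      using L_SVRG by (auto simp: draws_def)
    ultimately show ?thesis
      using uncorrelated[of "{Coin k}"] by (simp add: worker_draws_def bias_cases(1)[OF L_SVRG])
  next
    case SAGA
    show ?thesis
    proof (cases "l = i")
      case False
      have [measurable]: "J k i \<in> measurable (known {Component k i}) (count_space UNIV)"
        by (rule measurable_component) simp
      have "(\<lambda>p. of_bool (refreshed k i j p) :: real) \<in> borel_measurable (known {Component k i})"
        by (simp add: refreshed_cases(2)[OF SAGA])
      then show ?thesis
        using uncorrelated[of "{Component k i}"] i False by (auto simp: draws_def worker_draws_def)
    next
      case True
      have "(\<lambda>p. of_bool (refreshed k i j p) *\<^sub>R message k s l p) =
          (\<lambda>p. of_bool (J k i p = j) *\<^sub>R Q (\<xi> k i p) (estimate s i j - shift s i))"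
        using True by (auto simp: refreshed_cases(2)[OF SAGA] message_def)
      then show ?thesis
        using component_seed_expectation[OF i j Q_unbiased(1), of k "estimate s i j - shift s i"] True
        by (simp add: Q_unbiased(2) bias_cases(2)[OF SAGA])
    qed
  qed
  then show "integrable M (\<lambda>p. of_bool (refreshed k i j p) *\<^sub>R message k s l p)"
    and "expectation (\<lambda>p. of_bool (refreshed k i j p) *\<^sub>R message k s l p) =
      (worker_grad l (iterate s) - shift s l + (if l = i then bias s i j else 0)) /\<^sub>R real m"
    by auto
qed

lemma refreshed_direction:
  assumes i: "i \<in> {1..n}" and j: "j \<in> {1..m}"
  shows "integrable M (\<lambda>p. of_bool (refreshed k i j p) *\<^sub>R direction k s p)"
    and "expectation (\<lambda>p. of_bool (refreshed k i j p) *\<^sub>R direction k s p) =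
      (full_grad (iterate s) + bias s i j /\<^sub>R real n) /\<^sub>R real m"
proof -
  let ?b = "\<lambda>p. of_bool (refreshed k i j p) :: real"
  have eq: "(\<lambda>p. ?b p *\<^sub>R direction k s p) =
      (\<lambda>p. (1 / real n) *\<^sub>R (\<Sum>l\<in>{1..n}. ?b p *\<^sub>R message k s l p + ?b p *\<^sub>R shift s l))"
    unfolding direction_def
    by (simp only: scaleR_left_commute[of "of_bool _"] scaleR_sum_right scaleR_add_right)
  have int: "integrable M (\<lambda>p. ?b p *\<^sub>R message k s l p + ?b p *\<^sub>R shift s l)"
    "expectation (\<lambda>p. ?b p *\<^sub>R message k s l p + ?b p *\<^sub>R shift s l) =
      (worker_grad l (iterate s) + (if l = i then bias s i j else 0)) /\<^sub>R real m" if l: "l \<in> {1..n}" for l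
  proof -
    note 1 = refreshed_message[OF i j l, of k s] refreshed_probability[OF i j, of k]
    have 2: "integrable M (\<lambda>p. ?b p *\<^sub>R shift s l)" "expectation (\<lambda>p. ?b p *\<^sub>R shift s l) = shift s l /\<^sub>R real m"
      using 1(3,4) by (auto simp: divide_inverse)
    show "integrable M (\<lambda>p. ?b p *\<^sub>R message k s l p + ?b p *\<^sub>R shift s l)"
      by (rule Bochner_Integration.integrable_add[OF 1(1) 2(1)])
    show "expectation (\<lambda>p. ?b p *\<^sub>R message k s l p + ?b p *\<^sub>R shift s l) =
      (worker_grad l (iterate s) + (if l = i then bias s i j else 0)) /\<^sub>R real m"
      by (subst Bochner_Integration.integral_add[OF 1(1) 2(1)])
        (simp only: 1(2) 2(2) scaleR_add_right[symmetric], simp)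
  qed
  show "integrable M (\<lambda>p. ?b p *\<^sub>R direction k s p)"
    unfolding eq by (intro integrable_scaleR_right Bochner_Integration.integrable_sum int)
  have "expectation (\<lambda>p. ?b p *\<^sub>R direction k s p) = (1 / real n) *\<^sub>R
      (\<Sum>l\<in>{1..n}. expectation (\<lambda>p. ?b p *\<^sub>R message k s l p + ?b p *\<^sub>R shift s l))"
    unfolding eq by (subst integral_scaleR_right, subst Bochner_Integration.integral_sum) (use int(1) in auto)
  also have "\<dots> = (1 / real n) *\<^sub>R
      (\<Sum>l\<in>{1..n}. (worker_grad l (iterate s) + (if l = i then bias s i j else 0)) /\<^sub>R real m)"
    by (intro arg_cong[of _ _ "(*\<^sub>R) (1 / real n)"] sum.cong refl int(2))
  also have "\<dots> = (1 / real n) *\<^sub>R (((\<Sum>l\<in>{1..n}. worker_grad l (iterate s)) + bias s i j) /\<^sub>R real m)"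
    using i by (simp add: scaleR_sum_right[symmetric] sum.distrib)
  also have "\<dots> = (full_grad (iterate s) + bias s i j /\<^sub>R real n) /\<^sub>R real m"
    by (simp add: full_grad scaleR_add_right divide_inverse mult.commute)
  finally show "expectation (\<lambda>p. ?b p *\<^sub>R direction k s p) =
      (full_grad (iterate s) + bias s i j /\<^sub>R real n) /\<^sub>R real m" .
qed

text \<open>
  A refreshed reference point is the old iterate, at distance \<open>\<gamma> |G|\<close> from the new one. For the others the
  cross term \<open>G \<bullet> v\<close> is evaluated exactly; estimating it before averaging would lose the step size.
\<close>

lemma ref_pt_distance_step:
  fixes s :: "'v diana_state" and k i j :: nat
  defines "v \<equiv> iterate s - ref_pt s i j"
  assumes i: "i \<in> {1..n}" and j: "j \<in> {1..m}"
  shows "integrable M (\<lambda>p. (norm (iterate (step k s p) - ref_pt (step k s p) i j))\<^sup>2)"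
    and "expectation (\<lambda>p. (norm (iterate (step k s p) - ref_pt (step k s p) i j))\<^sup>2) =
      \<gamma>\<^sup>2 * expectation (\<lambda>p. (norm (direction k s p))\<^sup>2)
      + (1 - 1 / real m) * ((norm v)\<^sup>2 - 2 * \<gamma> * (full_grad (iterate s) \<bullet> v))
      + 2 * \<gamma> / (real m * real n) * (bias s i j \<bullet> v)"
proof -
  let ?b = "\<lambda>p. of_bool (refreshed k i j p) :: real"
  have eq: "(\<lambda>p. (norm (iterate (step k s p) - ref_pt (step k s p) i j))\<^sup>2) =
      (\<lambda>p. \<gamma>\<^sup>2 * (norm (direction k s p))\<^sup>2 + ((norm v)\<^sup>2 - 2 * \<gamma> * (direction k s p \<bullet> v))
        - ?b p * (norm v)\<^sup>2 + 2 * \<gamma> * ((?b p *\<^sub>R direction k s p) \<bullet> v))"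
  proof
    fix p
    have 1: "(norm (v - \<gamma> *\<^sub>R direction k s p))\<^sup>2 =
        \<gamma>\<^sup>2 * (norm (direction k s p))\<^sup>2 + ((norm v)\<^sup>2 - 2 * \<gamma> * (direction k s p \<bullet> v))"
      using norm_add_scaleR_sq[of v "- \<gamma>" "direction k s p"] by simp
    have 2: "iterate s - \<gamma> *\<^sub>R direction k s p - ref_pt s i j = v - \<gamma> *\<^sub>R direction k s p"
      by (simp add: v_def)
    show "(norm (iterate (step k s p) - ref_pt (step k s p) i j))\<^sup>2 =
        \<gamma>\<^sup>2 * (norm (direction k s p))\<^sup>2 + ((norm v)\<^sup>2 - 2 * \<gamma> * (direction k s p \<bullet> v))
        - ?b p * (norm v)\<^sup>2 + 2 * \<gamma> * ((?b p *\<^sub>R direction k s p) \<bullet> v)"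
      by (cases "refreshed k i j p") (simp_all add: iterate_step ref_pt_step power_mult_distrib 1 2)
  qed
  define N where "N p = (norm (direction k s p))\<^sup>2" for p
  define G where "G p = direction k s p \<bullet> v" for p
  define F where "F p = (?b p *\<^sub>R direction k s p) \<bullet> v" for p
  have ints: "integrable M N" "integrable M G" "integrable M F" "integrable M ?b"
    using direction_expectation(1)[of k s] direction_second_moment(1)[of k s]
      refreshed_direction(1)[OF i j, of k s] refreshed_probability(1)[OF i j, of k]
    unfolding N_def[abs_def] G_def[abs_def] F_def[abs_def] by (auto simp del: inner_scaleR_left)
  have G: "expectation G = full_grad (iterate s) \<bullet> v"
    unfolding G_def[abs_def] using direction_expectation[of k s] by simp
  have F: "expectation F = ((full_grad (iterate s) + bias s i j /\<^sub>R real n) /\<^sub>R real m) \<bullet> v"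
    unfolding F_def[abs_def] refreshed_direction(2)[OF i j, of k s, symmetric]
    by (rule integral_inner_left) (use refreshed_direction(1)[OF i j, of k s] in simp)
  note eq' = eq[folded N_def G_def F_def]
  show "integrable M (\<lambda>p. (norm (iterate (step k s p) - ref_pt (step k s p) i j))\<^sup>2)"
    unfolding eq' using ints by simp
  have "expectation (\<lambda>p. (norm (iterate (step k s p) - ref_pt (step k s p) i j))\<^sup>2) =
      \<gamma>\<^sup>2 * expectation (\<lambda>p. (norm (direction k s p))\<^sup>2) + ((norm v)\<^sup>2 - 2 * \<gamma> * (full_grad (iterate s) \<bullet> v))
      - 1 / real m * (norm v)\<^sup>2
      + 2 * \<gamma> * (((full_grad (iterate s) + bias s i j /\<^sub>R real n) /\<^sub>R real m) \<bullet> v)"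
    unfolding eq' N_def[symmetric] F[symmetric] G[symmetric]
    using ints by (simp add: prob_space refreshed_probability(2)[OF i j])
  also have "\<dots> = \<gamma>\<^sup>2 * expectation (\<lambda>p. (norm (direction k s p))\<^sup>2)
      + (1 - 1 / real m) * ((norm v)\<^sup>2 - 2 * \<gamma> * (full_grad (iterate s) \<bullet> v))
      + 2 * \<gamma> / (real m * real n) * (bias s i j \<bullet> v)"
    by (simp add: inner_add_left algebra_simps divide_inverse)
  finally show "expectation (\<lambda>p. (norm (iterate (step k s p) - ref_pt (step k s p) i j))\<^sup>2) =
      \<gamma>\<^sup>2 * expectation (\<lambda>p. (norm (direction k s p))\<^sup>2)
      + (1 - 1 / real m) * ((norm v)\<^sup>2 - 2 * \<gamma> * (full_grad (iterate s) \<bullet> v))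
      + 2 * \<gamma> / (real m * real n) * (bias s i j \<bullet> v)" .
qed

text \<open>
  Young's inequality with weight \<open>1/L\<close> balances the two factors, both of which are controlled by the error
  of the reference points on average over \<open>j\<close>.
\<close>

lemma bias_inner_le:
  assumes i: "i \<in> {1..n}"
  shows "(\<Sum>j\<in>{1..m}. bias s i j \<bullet> (iterate s - ref_pt s i j)) / real m \<le> L * ref_error s i"
proof (cases var)
  case L_SVRG
  show ?thesis
    using L_pos ref_error_nonneg[of s i] by (simp add: bias_cases(1)[OF L_SVRG])
next
  case SAGA
  have "bias s i j \<bullet> (iterate s - ref_pt s i j) \<le>
      (1 / (2 * L)) * (norm (estimate s i j - worker_grad i (iterate s)))\<^sup>2
      + L / 2 * (norm (iterate s - ref_pt s i j))\<^sup>2" for j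
    using two_inner_le[of "1 / L" "bias s i j" "iterate s - ref_pt s i j"] L_pos
    by (simp add: bias_cases(2)[OF SAGA] field_simps)
  then have "(\<Sum>j\<in>{1..m}. bias s i j \<bullet> (iterate s - ref_pt s i j)) / real m \<le>
      (\<Sum>j\<in>{1..m}. (1 / (2 * L)) * (norm (estimate s i j - worker_grad i (iterate s)))\<^sup>2
      + L / 2 * (norm (iterate s - ref_pt s i j))\<^sup>2) / real m"
    by (intro divide_right_mono sum_mono) auto
  also have "\<dots> = (1 / (2 * L)) * ((\<Sum>j\<in>{1..m}. (norm (estimate s i j - worker_grad i (iterate s)))\<^sup>2) / real m)
      + L / 2 * ref_error s i"
    by (simp only: ref_error_def sum.distrib sum_distrib_left[symmetric] add_divide_distrib times_divide_eq_right)
  also have "\<dots> \<le> (1 / (2 * L)) * (L\<^sup>2 * ref_error s i) + L / 2 * ref_error s i"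
    using estimate_variance[OF i, of s] L_pos by (intro add_right_mono mult_left_mono) auto
  also have "\<dots> = L * ref_error s i"
    using L_pos by (simp add: power2_eq_square)
  finally show ?thesis .
qed

text \<open>
  The remaining cross term \<open>g \<bullet> v\<close> is split by Young's inequality with weight \<open>5 m/2\<close>, so that it consumes
  the fraction \<open>2/5\<close> of the contraction \<open>1/m\<close> and leaves a multiple of \<open>|g|\<^sup>2\<close>.
\<close>

lemma mean_ref_error_step:
  "integrable M (\<lambda>p. mean_ref_error (step k s p))"
  "expectation (\<lambda>p. mean_ref_error (step k s p)) \<le>
     \<gamma>\<^sup>2 * expectation (\<lambda>p. (norm (direction k s p))\<^sup>2)
     + (1 - 1 / real m + 2 / (5 * real m) + 2 * \<gamma> * L / (real m * real n)) * mean_ref_error s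
     + 5 / 2 * \<gamma>\<^sup>2 * real m * (norm (full_grad (iterate s)))\<^sup>2"
proof -
  let ?D = "\<lambda>i j p. (norm (iterate (step k s p) - ref_pt (step k s p) i j))\<^sup>2"
  let ?v = "\<lambda>i j. iterate s - ref_pt s i j"
  let ?g = "full_grad (iterate s)"
  let ?E = "expectation (\<lambda>p. (norm (direction k s p))\<^sup>2)"
  let ?c = "1 - 1 / real m + 2 / (5 * real m)"
  have eq: "(\<lambda>p. mean_ref_error (step k s p)) = (\<lambda>p. (\<Sum>i\<in>{1..n}. (\<Sum>j\<in>{1..m}. ?D i j p) / real m) / real n)"
    by (simp add: mean_ref_error_def ref_error_def)
  show "integrable M (\<lambda>p. mean_ref_error (step k s p))"
    unfolding eq by (intro integrable_average ref_pt_distance_step(1))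
  have m1: "real m \<ge> 1" "real n \<ge> 1"
    using m_pos n_ge by auto
  have one: "expectation (?D i j) \<le> \<gamma>\<^sup>2 * ?E + ?c * (norm (?v i j))\<^sup>2 + 5 / 2 * \<gamma>\<^sup>2 * real m * (norm ?g)\<^sup>2
      + 2 * \<gamma> / (real m * real n) * (bias s i j \<bullet> ?v i j)" if "i \<in> {1..n}" "j \<in> {1..m}" for i j
  proof -
    \<comment> \<open>Young's inequality is applied to \<open>- \<gamma> g\<close>, because \<open>g \<bullet> v\<close> may have either sign.\<close>
    have "2 * (- \<gamma> *\<^sub>R ?g \<bullet> ?v i j) \<le> (5 * real m / 2) * (norm (- \<gamma> *\<^sub>R ?g))\<^sup>2 + (norm (?v i j))\<^sup>2 / (5 * real m / 2)"
      using m1 by (intro two_inner_le) auto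
    then have young: "- (2 * \<gamma> * (?g \<bullet> ?v i j)) \<le> 5 / 2 * \<gamma>\<^sup>2 * real m * (norm ?g)\<^sup>2 + 2 / (5 * real m) * (norm (?v i j))\<^sup>2"
      (is "_ \<le> ?Y")
      by (simp add: power_mult_distrib mult_ac)
    have "?Y \<ge> 0"
      by (intro add_nonneg_nonneg mult_nonneg_nonneg) auto
    have "(1 - 1 / real m) * (- (2 * \<gamma> * (?g \<bullet> ?v i j))) \<le> (1 - 1 / real m) * ?Y"
      using young m1 by (intro mult_left_mono) auto
    also have "\<dots> \<le> 1 * ?Y"
      using \<open>?Y \<ge> 0\<close> by (intro mult_right_mono) auto
    finally show ?thesis
      unfolding ref_pt_distance_step(2)[OF that] by (simp add: algebra_simps)
  qed
  have worker: "(\<Sum>j\<in>{1..m}. expectation (?D i j)) / real m \<le> \<gamma>\<^sup>2 * ?E + ?c * ref_error s i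
      + 5 / 2 * \<gamma>\<^sup>2 * real m * (norm ?g)\<^sup>2 + 2 * \<gamma> / (real m * real n) * (L * ref_error s i)" if i: "i \<in> {1..n}" for i
  proof -
    have "(\<Sum>j\<in>{1..m}. expectation (?D i j)) / real m \<le>
        (\<Sum>j\<in>{1..m}. \<gamma>\<^sup>2 * ?E + ?c * (norm (?v i j))\<^sup>2 + 5 / 2 * \<gamma>\<^sup>2 * real m * (norm ?g)\<^sup>2
          + 2 * \<gamma> / (real m * real n) * (bias s i j \<bullet> ?v i j)) / real m"
      by (intro divide_right_mono sum_mono one i) auto
    also have "\<dots> = \<gamma>\<^sup>2 * ?E + ?c * ref_error s i + 5 / 2 * \<gamma>\<^sup>2 * real m * (norm ?g)\<^sup>2
          + 2 * \<gamma> / (real m * real n) * ((\<Sum>j\<in>{1..m}. bias s i j \<bullet> ?v i j) / real m)"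
      using m1 by (simp only: sum.distrib sum_distrib_left[symmetric] ref_error_def add_divide_distrib
          sum_constant times_divide_eq_right card_atLeastAtMost) simp
    also have "\<dots> \<le> \<gamma>\<^sup>2 * ?E + ?c * ref_error s i + 5 / 2 * \<gamma>\<^sup>2 * real m * (norm ?g)\<^sup>2
          + 2 * \<gamma> / (real m * real n) * (L * ref_error s i)"
      using bias_inner_le[OF i, of s] \<gamma>_pos by (intro add_left_mono mult_left_mono) auto
    finally show ?thesis .
  qed
  have "expectation (\<lambda>p. mean_ref_error (step k s p)) =
      (\<Sum>i\<in>{1..n}. (\<Sum>j\<in>{1..m}. expectation (?D i j)) / real m) / real n"
    unfolding eq
    by (simp only: integral_average[where A="{1..n}"] integral_average[where A="{1..m}"] integrable_average
        ref_pt_distance_step(1) cong: sum.cong)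
  also have "\<dots> \<le> (\<Sum>i\<in>{1..n}. \<gamma>\<^sup>2 * ?E + ?c * ref_error s i
      + 5 / 2 * \<gamma>\<^sup>2 * real m * (norm ?g)\<^sup>2 + 2 * \<gamma> / (real m * real n) * (L * ref_error s i)) / real n"
    by (intro divide_right_mono sum_mono worker) auto
  also have "\<dots> = \<gamma>\<^sup>2 * ?E + (?c + 2 * \<gamma> * L / (real m * real n)) * mean_ref_error s
     + 5 / 2 * \<gamma>\<^sup>2 * real m * (norm ?g)\<^sup>2"
    using m1 by (simp only: sum.distrib sum_distrib_left[symmetric] mean_ref_error_def add_divide_distrib
          sum_constant times_divide_eq_right card_atLeastAtMost)
      (simp add: algebra_simps add_divide_distrib diff_divide_distrib)
  finally show "expectation (\<lambda>p. mean_ref_error (step k s p)) \<le>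
     \<gamma>\<^sup>2 * ?E + (?c + 2 * \<gamma> * L / (real m * real n)) * mean_ref_error s
     + 5 / 2 * \<gamma>\<^sup>2 * real m * (norm ?g)\<^sup>2" .
qed

section \<open>Decrease of the potential in one round\<close>

text \<open>
  Error of the new shift against the gradient at the old iterate; the move of the iterate is accounted for
  separately in \<open>shift_error_step_le\<close>.
\<close>

definition shift_update_error :: "nat \<Rightarrow> 'v diana_state \<Rightarrow> nat \<Rightarrow> 'p \<Rightarrow> real" where
  "shift_update_error k s i p = (norm (shift s i + \<alpha> *\<^sub>R message k s i p - worker_grad i (iterate s)))\<^sup>2"

text \<open>
  The new shift is \<open>h\<^sub>i\<close> moved by \<open>\<alpha>\<close> times an unbiased estimate of \<open>\<nabla>f\<^sub>i(x) - h\<^sub>i\<close>. The choice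
  \<open>\<alpha> (\<omega> + 1) = 1\<close> lets the noise \<open>\<alpha>\<^sup>2 (\<omega> + 1)\<close> eat only half of the gain \<open>2 \<alpha>\<close>.
\<close>

lemma shift_update_error_expectation:
  assumes i: "i \<in> {1..n}"
  shows "integrable M (shift_update_error k s i)"
    and "expectation (shift_update_error k s i) \<le> (1 - \<alpha>) * shift_error s i + \<alpha> * (L\<^sup>2 * ref_error s i)"
proof -
  define \<delta> where "\<delta> = shift s i - worker_grad i (iterate s)"
  define N where "N p = (norm (message k s i p))\<^sup>2" for p
  define G where "G p = message k s i p \<bullet> \<delta>" for p
  have "shift_update_error k s i p = (norm (\<delta> + \<alpha> *\<^sub>R message k s i p))\<^sup>2" for p
    by (simp add: shift_update_error_def \<delta>_def algebra_simps)
  then have eq: "shift_update_error k s i = (\<lambda>p. (norm \<delta>)\<^sup>2 + 2 * \<alpha> * G p + \<alpha>\<^sup>2 * N p)"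
    by (simp add: fun_eq_iff norm_add_scaleR_sq G_def N_def)
  have ints: "integrable M N" "integrable M G"
    using message_second_moment(1)[OF i, of k s] message_expectation(1)[OF i, of k s]
    unfolding N_def[abs_def] G_def[abs_def] by auto
  have G: "expectation G = - (norm \<delta>)\<^sup>2"
  proof -
    have "expectation G = (worker_grad i (iterate s) - shift s i) \<bullet> \<delta>"
      unfolding G_def[abs_def] using message_expectation[OF i, of k s] by simp
    also have "\<dots> = - (\<delta> \<bullet> \<delta>)"
      by (simp add: \<delta>_def inner_minus_left[symmetric] del: inner_minus_left)
    finally show ?thesis
      by (simp add: power2_norm_eq_inner)
  qed
  show "integrable M (shift_update_error k s i)"
    unfolding eq using ints by simp
  have "expectation (shift_update_error k s i) = (norm \<delta>)\<^sup>2 - 2 * \<alpha> * (norm \<delta>)\<^sup>2 + \<alpha>\<^sup>2 * expectation N"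
    unfolding eq using ints by (simp add: prob_space G)
  also have "\<dots> \<le> (norm \<delta>)\<^sup>2 - 2 * \<alpha> * (norm \<delta>)\<^sup>2 + \<alpha>\<^sup>2 * ((\<omega> + 1) * ((norm \<delta>)\<^sup>2 + L\<^sup>2 * ref_error s i))"
    using message_second_moment(2)[OF i, of k s] unfolding N_def[abs_def] \<delta>_def
    by (intro add_left_mono mult_left_mono) auto
  also have "\<alpha>\<^sup>2 * ((\<omega> + 1) * ((norm \<delta>)\<^sup>2 + L\<^sup>2 * ref_error s i)) = \<alpha> * ((norm \<delta>)\<^sup>2 + L\<^sup>2 * ref_error s i)"
    using \<omega>_nonneg by (simp add: \<alpha> power2_eq_square)
  finally show "expectation (shift_update_error k s i) \<le> (1 - \<alpha>) * shift_error s i + \<alpha> * (L\<^sup>2 * ref_error s i)"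
    by (simp add: shift_error_def \<delta>_def algebra_simps)
qed

text \<open>
  Young's inequality with weight \<open>\<alpha>/2\<close>, which gives away half of the contraction \<open>1 - \<alpha>\<close>.
\<close>

lemma shift_error_step_le:
  assumes i: "i \<in> {1..n}"
  shows "shift_error (step k s p) i \<le>
    (1 + \<alpha> / 2) * shift_update_error k s i p + (1 + 2 / \<alpha>) * L\<^sup>2 * \<gamma>\<^sup>2 * (norm (direction k s p))\<^sup>2"
proof -
  let ?x = "iterate s" and ?x' = "iterate s - \<gamma> *\<^sub>R direction k s p"
  have "(norm (worker_grad i ?x - worker_grad i ?x'))\<^sup>2 \<le> (L * norm (?x - ?x'))\<^sup>2"
    by (intro power_mono worker_grad_lipschitz i) auto
  then have lip: "(norm (worker_grad i ?x - worker_grad i ?x'))\<^sup>2 \<le> L\<^sup>2 * \<gamma>\<^sup>2 * (norm (direction k s p))\<^sup>2"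
    by (simp add: power_mult_distrib)
  have "shift_error (step k s p) i =
      (norm ((shift s i + \<alpha> *\<^sub>R message k s i p - worker_grad i ?x) + (worker_grad i ?x - worker_grad i ?x')))\<^sup>2"
    by (simp add: shift_error_def shift_step iterate_step)
  also have "\<dots> \<le> (1 + \<alpha> / 2) * shift_update_error k s i p
      + (1 + 1 / (\<alpha> / 2)) * (norm (worker_grad i ?x - worker_grad i ?x'))\<^sup>2"
    unfolding shift_update_error_def using \<alpha>_pos by (intro norm_add_sq_le) auto
  also have "\<dots> \<le> (1 + \<alpha> / 2) * shift_update_error k s i p
      + (1 + 1 / (\<alpha> / 2)) * (L\<^sup>2 * \<gamma>\<^sup>2 * (norm (direction k s p))\<^sup>2)"
    using lip \<alpha>_pos by (intro add_left_mono mult_left_mono) auto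
  finally show ?thesis
    by (simp add: mult.assoc)
qed

definition ref_weight :: real where
  "ref_weight = real m / (10 * (real m powr (2 / 3) + \<omega> + 1)\<^sup>2)"

definition shift_weight :: real where
  "shift_weight = 2 * \<gamma>\<^sup>2 * L * (\<omega> + 1) * (\<omega> / real n)"

definition potential :: "real \<Rightarrow> 'v diana_state \<Rightarrow> real" where
  "potential fmin s = objective n m f (iterate s) - fmin
     + ref_weight * L * mean_ref_error s + shift_weight * mean_shift_error s"

lemma weights_nonneg: "ref_weight \<ge> 0" "shift_weight \<ge> 0"
  using L_pos \<omega>_nonneg by (auto simp: ref_weight_def shift_weight_def)

lemma mean_errors_nonneg: "mean_ref_error s \<ge> 0" "mean_shift_error s \<ge> 0"
  by (auto simp: mean_ref_error_def mean_shift_error_def shift_error_def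
      intro!: divide_nonneg_nonneg sum_nonneg ref_error_nonneg)

lemma potential_nonneg: "(\<And>y. fmin \<le> objective n m f y) \<Longrightarrow> potential fmin s \<ge> 0"
  unfolding potential_def using weights_nonneg mean_errors_nonneg L_pos
  by (intro add_nonneg_nonneg mult_nonneg_nonneg) auto

text \<open>
  The second statement makes the right-hand side of the first one nonnegative, so that \<open>ennreal\<close> does not
  truncate it.
\<close>

lemma potential_descent:
  assumes fmin: "\<And>y. fmin \<le> objective n m f y"
  shows "(\<integral>\<^sup>+p. ennreal (potential fmin (step k s p)) \<partial>M)
      \<le> ennreal (potential fmin s - \<gamma> / 4 * (norm (full_grad (iterate s)))\<^sup>2)"
    and "\<gamma> / 4 * (norm (full_grad (iterate s)))\<^sup>2 \<le> potential fmin s"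
proof -
  let ?g = "full_grad (iterate s)"
  define N where "N p = (norm (direction k s p))\<^sup>2" for p
  define G where "G p = direction k s p \<bullet> ?g" for p
  define W where "W p = mean_ref_error (step k s p)" for p
  define H where "H p = (\<Sum>i\<in>{1..n}. shift_update_error k s i p) / real n" for p
  define c where "c = (1 + 2 / \<alpha>) * L\<^sup>2 * \<gamma>\<^sup>2"
  \<comment> \<open>An integrable majorant of the potential after the step; only its expectation is computed.\<close>
  define T where "T p = objective n m f (iterate s) - fmin - \<gamma> * G p + L / 2 * \<gamma>\<^sup>2 * N p
      + ref_weight * L * W p + shift_weight * ((1 + \<alpha> / 2) * H p + c * N p)" for p
  have m1: "real m \<ge> 1" "real n \<ge> 1"
    using m_pos n_ge by auto
  have le: "potential fmin (step k s p) \<le> T p" for p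
  proof -
    have "objective n m f (iterate (step k s p)) \<le> objective n m f (iterate s) - \<gamma> * G p + L / 2 * \<gamma>\<^sup>2 * N p"
      using objective_smooth[of "iterate (step k s p)" "iterate s"]
      by (simp add: iterate_step G_def N_def inner_commute power_mult_distrib)
    moreover have "mean_shift_error (step k s p) \<le> (1 + \<alpha> / 2) * H p + c * N p"
    proof -
      have "mean_shift_error (step k s p) \<le>
          (\<Sum>i\<in>{1..n}. (1 + \<alpha> / 2) * shift_update_error k s i p + c * N p) / real n"
        unfolding mean_shift_error_def c_def N_def
        by (intro divide_right_mono sum_mono shift_error_step_le) auto
      also have "\<dots> = (1 + \<alpha> / 2) * H p + c * N p"
        using m1 by (simp only: H_def sum.distrib sum_distrib_left[symmetric] add_divide_distrib
            sum_constant times_divide_eq_right card_atLeastAtMost) simp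
      finally show ?thesis .
    qed
    then have "shift_weight * mean_shift_error (step k s p) \<le> shift_weight * ((1 + \<alpha> / 2) * H p + c * N p)"
      using weights_nonneg by (intro mult_left_mono)
    ultimately show ?thesis
      by (simp add: potential_def T_def W_def)
  qed
  have "integrable M H"
    unfolding H_def[abs_def] by (intro integrable_average shift_update_error_expectation)
  then have ints: "integrable M N" "integrable M G" "integrable M W" "integrable M H"
    using direction_second_moment(1)[of k s] direction_expectation(1)[of k s] mean_ref_error_step(1)[of k s]
    unfolding N_def[abs_def] G_def[abs_def] W_def[abs_def] by auto
  have EG: "expectation G = (norm ?g)\<^sup>2"
    unfolding G_def[abs_def] using direction_expectation[of k s] by (simp add: power2_norm_eq_inner)
  have EH: "expectation H \<le> (1 - \<alpha>) * mean_shift_error s + \<alpha> * L\<^sup>2 * mean_ref_error s"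
  proof -
    have "expectation H = (\<Sum>i\<in>{1..n}. expectation (shift_update_error k s i)) / real n"
      unfolding H_def[abs_def] by (intro integral_average shift_update_error_expectation)
    also have "\<dots> \<le> (\<Sum>i\<in>{1..n}. (1 - \<alpha>) * shift_error s i + \<alpha> * L\<^sup>2 * ref_error s i) / real n"
      using shift_update_error_expectation(2)[of _ k s]
      by (intro divide_right_mono sum_mono) (auto simp: mult.assoc)
    also have "\<dots> = (1 - \<alpha>) * mean_shift_error s + \<alpha> * L\<^sup>2 * mean_ref_error s"
      by (simp only: mean_shift_error_def mean_ref_error_def sum.distrib sum_distrib_left[symmetric]
          add_divide_distrib times_divide_eq_right)
    finally show ?thesis .
  qed
  have Tint: "integrable M T"
    unfolding T_def[abs_def] using ints by simp
  have ET: "expectation T = objective n m f (iterate s) - fmin + (- \<gamma> * (norm ?g)\<^sup>2 + L / 2 * \<gamma>\<^sup>2 * expectation N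
      + ref_weight * L * expectation W + shift_weight * ((1 + \<alpha> / 2) * expectation H + c * expectation N))"
    unfolding T_def[abs_def] using ints by (simp add: prob_space EG)
  define q where "q = real m powr (2 / 3) + \<omega> + 1"
  have q1: "q \<ge> real m powr (2 / 3)"
    using \<omega>_nonneg by (simp add: q_def)
  have "- \<gamma> * (norm ?g)\<^sup>2 + L / 2 * \<gamma>\<^sup>2 * expectation N
      + ref_weight * L * expectation W + shift_weight * ((1 + \<alpha> / 2) * expectation H + c * expectation N)
    \<le> - \<gamma> * (norm ?g)\<^sup>2 + L / 2 * \<gamma>\<^sup>2 * expectation N
      + ref_weight * L * (\<gamma>\<^sup>2 * expectation N
         + (1 - 1 / real m + 2 / (5 * real m) + 2 * \<gamma> * L / (real m * real n)) * mean_ref_error s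
         + 5 / 2 * \<gamma>\<^sup>2 * real m * (norm ?g)\<^sup>2)
      + shift_weight * ((1 + \<alpha> / 2) * ((1 - \<alpha>) * mean_shift_error s + \<alpha> * L\<^sup>2 * mean_ref_error s) + c * expectation N)"
    using EH mean_ref_error_step(2)[of k s] weights_nonneg L_pos \<alpha>_pos
    unfolding W_def[abs_def] N_def[abs_def]
    by (intro add_mono mult_left_mono order_refl) auto
  also have "\<dots> \<le> ref_weight * L * mean_ref_error s + shift_weight * mean_shift_error s - \<gamma> / 4 * (norm ?g)\<^sup>2"
    unfolding c_def
  proof (rule lyapunov_coefficients[where q=q and s="sqrt (1 + \<omega> / real n)" and w=\<omega>])
    show "q \<ge> \<omega> + 1"
      by (simp add: q_def)
    have "real m = real m powr 1"
      using m1 by simp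
    also have "\<dots> \<le> real m powr (4 / 3)"
      using m1 by (intro powr_mono) auto
    also have "\<dots> = (real m powr (2 / 3))\<^sup>2"
      using m1 by (simp add: powr_power)
    also have "\<dots> \<le> q\<^sup>2"
      using q1 by (intro power_mono) auto
    finally show "q\<^sup>2 \<ge> real m" .
    have "(real m)\<^sup>2 = (real m powr (2 / 3)) ^ 3"
      using m1 by (simp add: powr_power)
    also have "\<dots> \<le> q ^ 3"
      using q1 by (intro power_mono) auto
    finally show "q ^ 3 \<ge> (real m)\<^sup>2" .
    show "\<gamma> * L * sqrt (1 + \<omega> / real n) * q = 1 / 10"
    proof -
      have "sqrt (1 + \<omega> / real n) > 0"
        using \<omega>_nonneg by (intro real_sqrt_gt_zero add_pos_nonneg) auto
      moreover have "q > 0"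
        using \<omega>_nonneg by (simp add: q_def add_nonneg_pos add_nonneg_nonneg)
      ultimately show ?thesis
        using L_pos by (simp add: \<gamma> q_def[symmetric])
    qed
    show "expectation N \<le> (norm ?g)\<^sup>2 + \<omega> / real n * mean_shift_error s + (\<omega> + 1) / real n * L\<^sup>2 * mean_ref_error s"
      using direction_second_moment(2)[of k s] by (simp add: N_def[abs_def])
  qed (use m1 L_pos \<omega>_nonneg \<gamma>_pos mean_errors_nonneg in
      \<open>auto simp: \<alpha> ref_weight_def shift_weight_def q_def\<close>)
  finally have bound: "expectation T \<le> potential fmin s - \<gamma> / 4 * (norm ?g)\<^sup>2"
    unfolding ET potential_def by simp
  have T0: "T p \<ge> 0" for p
    using le[of p] potential_nonneg[OF fmin, of "step k s p"] by linarith
  have "(\<integral>\<^sup>+p. ennreal (potential fmin (step k s p)) \<partial>M) \<le> (\<integral>\<^sup>+p. ennreal (T p) \<partial>M)"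
    by (intro nn_integral_mono ennreal_leI le)
  also have "\<dots> = ennreal (expectation T)"
    using Tint T0 by (intro nn_integral_eq_integral) auto
  also have "\<dots> \<le> ennreal (potential fmin s - \<gamma> / 4 * (norm ?g)\<^sup>2)"
    using bound by (rule ennreal_leI)
  finally show "(\<integral>\<^sup>+p. ennreal (potential fmin (step k s p)) \<partial>M)
      \<le> ennreal (potential fmin s - \<gamma> / 4 * (norm (full_grad (iterate s)))\<^sup>2)" .
  have "expectation T \<ge> 0"
    using T0 by (intro integral_nonneg_AE) auto
  with bound show "\<gamma> / 4 * (norm (full_grad (iterate s)))\<^sup>2 \<le> potential fmin s"
    by linarith
qed

end

section \<open>The whole run\<close>

locale vr_diana_process = vr_diana_run M var n m R K u J \<xi> a f L Q \<omega> \<alpha> \<gamma>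
  for M :: "'p measure" and var n m and R :: "'r measure" and K u J \<xi> a
    and f :: "nat \<Rightarrow> nat \<Rightarrow> 'v::euclidean_space \<Rightarrow> real" and L Q \<omega> \<alpha> \<gamma> +
  fixes x0 :: 'v and h0 :: "nat \<Rightarrow> 'v" and w0 :: "nat \<Rightarrow> nat \<Rightarrow> 'v" and fmin :: real
  assumes init_w: "\<And>i j. i \<in> {1..n} \<Longrightarrow> j \<in> {1..m} \<Longrightarrow> w0 i j = x0"
    and init_h: "\<And>i. i \<in> {1..n} \<Longrightarrow> h0 i = worker_grad i x0"
    and fmin: "\<And>y. fmin \<le> objective n m f y"
begin

definition state :: "nat \<Rightarrow> 'p \<Rightarrow> 'v diana_state" where
  "state k p = vr_diana var \<alpha> \<gamma> n m f Q x0 h0 w0 (\<lambda>k. u k p) (\<lambda>k i. J k i p) (\<lambda>k i. \<xi> k i p) k"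

lemma state_0: "state 0 p = \<lparr>iterate = x0, shift = h0, ref_pt = w0\<rparr>"
  and state_Suc: "state (Suc k) p = step k (state k p) p"
  by (simp_all add: state_def step_def)

definition round_draws :: "nat \<Rightarrow> draw set" where
  "round_draws k = {Coin k |_::unit. var = L_SVRG} \<union> (\<Union>i\<in>{1..n}. worker_draws k i)"

definition past_draws :: "nat \<Rightarrow> draw set" where
  "past_draws k = (\<Union>l<k. round_draws l)"

lemma past_draws_subset: "past_draws k \<subseteq> draws var n"
  and round_draws_subset: "round_draws k \<subseteq> draws var n"
  by (auto simp: past_draws_def round_draws_def worker_draws_def draws_def)

lemma past_draws_disjoint: "past_draws k \<inter> round_draws k = {}" "past_draws k \<inter> {Output_Index} = {}"
  by (auto simp: past_draws_def round_draws_def worker_draws_def)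

lemma measurable_round_draws:
  assumes "round_draws k \<subseteq> A"
  shows "var = L_SVRG \<Longrightarrow> u k \<in> measurable (known A) (count_space UNIV)"
    and "i \<in> {1..n} \<Longrightarrow> J k i \<in> measurable (known A) (count_space UNIV)"
    and "i \<in> {1..n} \<Longrightarrow> \<xi> k i \<in> measurable (known A) R"
proof -
  show "u k \<in> measurable (known A) (count_space UNIV)" if "var = L_SVRG"
    by (rule measurable_coin) (use assms that in \<open>unfold round_draws_def, blast\<close>)
  have worker: "worker_draws k i \<subseteq> A" if "i \<in> {1..n}"
    using assms that unfolding round_draws_def by blast
  then show "J k i \<in> measurable (known A) (count_space UNIV)" if "i \<in> {1..n}"
    using that by (intro measurable_component) (auto simp: worker_draws_def)
  show "\<xi> k i \<in> measurable (known A) R" if "i \<in> {1..n}"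
    using worker[OF that] by (intro measurable_seed that) (auto simp: worker_draws_def)
qed

lemma measurable_state_state: "measurable_state (known (past_draws k)) n (state k)"
proof (induction k)
  case 0
  show ?case
    by (simp add: measurable_state_def state_0)
next
  case (Suc k)
  have sub: "past_draws k \<subseteq> past_draws (Suc k)" "round_draws k \<subseteq> past_draws (Suc k)"
    by (auto simp: past_draws_def lessThan_Suc)
  have "measurable_state (known (past_draws (Suc k))) n (state k)"
    by (rule measurable_state_compose[OF measurable_known_mono[OF sub(1) measurable_ident_sets[OF refl]] Suc])
  from measurable_diana_step[OF Q_measurable this measurable_round_draws[OF sub(2)]]
  show ?case
    by (simp add: state_Suc step_def)
qed

lemma measurable_state_step:
  "measurable_state (known (past_draws k) \<Otimes>\<^sub>M known (round_draws k)) n (\<lambda>(p, p'). step k (state k p) p')"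
proof -
  have st: "measurable_state (known (past_draws k) \<Otimes>\<^sub>M known (round_draws k)) n (\<lambda>z. state k (fst z))"
    by (rule measurable_state_compose[OF measurable_fst measurable_state_state])
  note r = measurable_round_draws[OF subset_refl, THEN measurable_compose[OF measurable_snd]]
  show ?thesis
    using measurable_diana_step[OF Q_measurable st r] by (simp add: step_def case_prod_beta')
qed

lemma measurable_potential:
  assumes "measurable_state N n s"
  shows "(\<lambda>p. potential fmin (s p)) \<in> borel_measurable N"
proof -
  have x [measurable]: "(\<lambda>p. iterate (s p)) \<in> borel_measurable N"
    and h: "\<And>i. i \<in> {1..n} \<Longrightarrow> (\<lambda>p. shift (s p) i) \<in> borel_measurable N"
    and w: "\<And>i j. i \<in> {1..n} \<Longrightarrow> (\<lambda>p. ref_pt (s p) i j) \<in> borel_measurable N"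
    using assms by (auto simp: measurable_state_def)
  have "continuous_on UNIV (objective n m f)"
    using GDERIV_objective unfolding gderiv_def
    by (intro continuous_at_imp_continuous_on) (blast intro: has_derivative_continuous)
  then have [measurable]: "objective n m f \<in> borel_measurable borel"
    by (rule borel_measurable_continuous_onI)
  have "(\<lambda>p. mean_ref_error (s p)) \<in> borel_measurable N"
    unfolding mean_ref_error_def ref_error_def using x w
    by (intro borel_measurable_divide borel_measurable_sum borel_measurable_power borel_measurable_norm
        borel_measurable_diff borel_measurable_const) auto
  moreover have "(\<lambda>p. mean_shift_error (s p)) \<in> borel_measurable N"
    unfolding mean_shift_error_def shift_error_def using h
    by (intro borel_measurable_divide borel_measurable_sum borel_measurable_power borel_measurable_norm
        borel_measurable_diff borel_measurable_const measurable_compose[OF x borel_measurable_gradient]) auto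
  ultimately show ?thesis
    unfolding potential_def by measurable
qed

definition grad_sq :: "nat \<Rightarrow> 'p \<Rightarrow> real" where
  "grad_sq k p = (norm (full_grad (iterate (state k p))))\<^sup>2"

lemma grad_sq_nonneg: "grad_sq k p \<ge> 0"
  by (simp add: grad_sq_def)

lemma measurable_grad_sq: "grad_sq k \<in> borel_measurable (known (past_draws k))"
proof -
  have "(\<lambda>p. iterate (state k p)) \<in> borel_measurable (known (past_draws k))"
    using measurable_state_state by (simp add: measurable_state_def)
  from measurable_compose[OF this borel_measurable_gradient, of "objective n m f"] show ?thesis
    unfolding grad_sq_def[abs_def] by measurable
qed

text \<open>
  The state before round \<open>k\<close> is a function of the past draws and the step a function of the draws of
  round \<open>k\<close>, so the estimate for fixed states integrates to one for the random state.
\<close>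

lemma expected_descent:
  "(\<integral>\<^sup>+p. ennreal (\<gamma> / 4 * grad_sq k p) \<partial>M) + (\<integral>\<^sup>+p. ennreal (potential fmin (state (Suc k) p)) \<partial>M)
    \<le> (\<integral>\<^sup>+p. ennreal (potential fmin (state k p)) \<partial>M)"
proof -
  note sub = past_draws_subset round_draws_subset
  have indep: "indep_set (sets (known (past_draws k))) (sets (known (round_draws k)))"
    by (intro indep_known sub past_draws_disjoint)
  have \<Phi>: "(\<lambda>(p, p'). ennreal (potential fmin (step k (state k p) p')))
      \<in> borel_measurable (known (past_draws k) \<Otimes>\<^sub>M known (round_draws k))"
    using measurable_potential[OF measurable_state_step] by (simp add: case_prod_beta')
  have pot: "(\<lambda>p. potential fmin (state k p)) \<in> borel_measurable M"
    by (rule measurable_knownI[OF past_draws_subset measurable_potential[OF measurable_state_state]])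
  have grad: "grad_sq k \<in> borel_measurable M"
    by (rule measurable_knownI[OF past_draws_subset measurable_grad_sq])
  have le: "\<gamma> / 4 * grad_sq k p \<le> potential fmin (state k p)" for p
    unfolding grad_sq_def by (rule potential_descent(2)[OF fmin])
  have g0: "0 \<le> \<gamma> / 4 * grad_sq k p" for p
    using \<gamma>_pos by (simp add: grad_sq_def)
  have "(\<integral>\<^sup>+p. ennreal (potential fmin (state (Suc k) p)) \<partial>M) =
      (\<integral>\<^sup>+p. \<integral>\<^sup>+p'. ennreal (potential fmin (step k (state k p) p')) \<partial>M \<partial>M)"
    unfolding state_Suc by (rule nn_integral_indep_diagonal[OF indep space_known space_known \<Phi>])
  also have "\<dots> \<le> (\<integral>\<^sup>+p. ennreal (potential fmin (state k p) - \<gamma> / 4 * grad_sq k p) \<partial>M)"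
    unfolding grad_sq_def by (intro nn_integral_mono potential_descent(1)[OF fmin])
  finally have "(\<integral>\<^sup>+p. ennreal (\<gamma> / 4 * grad_sq k p) \<partial>M) + (\<integral>\<^sup>+p. ennreal (potential fmin (state (Suc k) p)) \<partial>M)
    \<le> (\<integral>\<^sup>+p. ennreal (\<gamma> / 4 * grad_sq k p) \<partial>M)
      + (\<integral>\<^sup>+p. ennreal (potential fmin (state k p) - \<gamma> / 4 * grad_sq k p) \<partial>M)"
    by (rule add_left_mono)
  also have "\<dots> = (\<integral>\<^sup>+p. ennreal (\<gamma> / 4 * grad_sq k p)
      + ennreal (potential fmin (state k p) - \<gamma> / 4 * grad_sq k p) \<partial>M)"
    using pot grad by (intro nn_integral_add[symmetric]) auto
  also have "\<dots> = (\<integral>\<^sup>+p. ennreal (potential fmin (state k p)) \<partial>M)"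
  proof (rule nn_integral_cong)
    fix p
    show "ennreal (\<gamma> / 4 * grad_sq k p) + ennreal (potential fmin (state k p) - \<gamma> / 4 * grad_sq k p)
        = ennreal (potential fmin (state k p))"
      using le[of p] g0[of p] by (subst ennreal_plus[symmetric]) auto
  qed
  finally show ?thesis .
qed

lemma sum_expected_grad_sq:
  "(\<Sum>k<N. \<integral>\<^sup>+p. ennreal (\<gamma> / 4 * grad_sq k p) \<partial>M) \<le> ennreal (objective n m f x0 - fmin)"
proof -
  have telescope: "(\<Sum>k<N. \<integral>\<^sup>+p. ennreal (\<gamma> / 4 * grad_sq k p) \<partial>M) + (\<integral>\<^sup>+p. ennreal (potential fmin (state N p)) \<partial>M)
      \<le> (\<integral>\<^sup>+p. ennreal (potential fmin (state 0 p)) \<partial>M)" for N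
  proof (induction N)
    case (Suc N)
    have "(\<Sum>k<Suc N. \<integral>\<^sup>+p. ennreal (\<gamma> / 4 * grad_sq k p) \<partial>M) + (\<integral>\<^sup>+p. ennreal (potential fmin (state (Suc N) p)) \<partial>M)
        = (\<Sum>k<N. \<integral>\<^sup>+p. ennreal (\<gamma> / 4 * grad_sq k p) \<partial>M)
          + ((\<integral>\<^sup>+p. ennreal (\<gamma> / 4 * grad_sq N p) \<partial>M) + (\<integral>\<^sup>+p. ennreal (potential fmin (state (Suc N) p)) \<partial>M))"
      by (simp add: add.assoc)
    also have "\<dots> \<le> (\<Sum>k<N. \<integral>\<^sup>+p. ennreal (\<gamma> / 4 * grad_sq k p) \<partial>M) + (\<integral>\<^sup>+p. ennreal (potential fmin (state N p)) \<partial>M)"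
      by (intro add_left_mono expected_descent)
    also note Suc
    finally show ?case .
  qed simp
  have "(\<Sum>k<N. \<integral>\<^sup>+p. ennreal (\<gamma> / 4 * grad_sq k p) \<partial>M)
      \<le> (\<Sum>k<N. \<integral>\<^sup>+p. ennreal (\<gamma> / 4 * grad_sq k p) \<partial>M) + (\<integral>\<^sup>+p. ennreal (potential fmin (state N p)) \<partial>M)"
    by simp
  also note telescope
  also have "(\<integral>\<^sup>+p. ennreal (potential fmin (state 0 p)) \<partial>M) = (\<integral>\<^sup>+p. ennreal (objective n m f x0 - fmin) \<partial>M)"
    using init_w init_h
    by (simp add: potential_def state_0 mean_ref_error_def ref_error_def mean_shift_error_def shift_error_def)
  finally show ?thesis
    by (simp add: emeasure_space_1)
qed

text \<open>
  The iterates do not involve the output index, which selects each of them with probability \<open>1/K\<close>.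
\<close>

lemma nn_integral_output:
  "(\<integral>\<^sup>+p. ennreal (grad_sq (a p) p) \<partial>M) = (\<Sum>k<K. \<integral>\<^sup>+p. ennreal (grad_sq k p) \<partial>M) * ennreal (1 / real K)"
proof -
  have A: "a \<in> measurable (known {Output_Index}) (count_space UNIV)"
    by (rule measurable_output_index) simp
  have sub: "{Output_Index} \<subseteq> draws var n"
    by (simp add: draws_def)
  have [measurable]: "a \<in> measurable M (count_space UNIV)"
    by (rule measurable_knownI[OF sub A])
  have [measurable]: "grad_sq k \<in> borel_measurable M" for k
    by (rule measurable_knownI[OF past_draws_subset measurable_grad_sq])
  have "(\<integral>\<^sup>+p. ennreal (grad_sq (a p) p) \<partial>M) = (\<integral>\<^sup>+p. (\<Sum>k<K. ennreal (grad_sq k p) * of_bool (a p = k)) \<partial>M)"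
  proof (rule nn_integral_cong_AE)
    show "AE p in M. ennreal (grad_sq (a p) p) = (\<Sum>k<K. ennreal (grad_sq k p) * of_bool (a p = k))"
      using output_index_in_range
    proof eventually_elim
      case (elim p)
      have "(\<Sum>k<K. ennreal (grad_sq k p) * of_bool (a p = k)) = (\<Sum>k<K. if a p = k then ennreal (grad_sq k p) else 0)"
        by (intro sum.cong) auto
      with elim show ?case
        by simp
    qed
  qed
  also have "\<dots> = (\<Sum>k<K. \<integral>\<^sup>+p. ennreal (grad_sq k p) * of_bool (a p = k) \<partial>M)"
    by (intro nn_integral_sum) measurable
  also have "\<dots> = (\<Sum>k<K. (\<integral>\<^sup>+p. ennreal (grad_sq k p) \<partial>M) * ennreal (1 / real K))"
  proof (rule sum.cong[OF refl])
    fix k assume k: "k \<in> {..<K}"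
    have indep: "indep_set (sets (known (past_draws k))) (sets (known {Output_Index}))"
      by (intro indep_known sub past_draws_subset past_draws_disjoint)
    have \<Phi>: "(\<lambda>(p, p'). ennreal (grad_sq k p) * of_bool (a p' = k))
        \<in> borel_measurable (known (past_draws k) \<Otimes>\<^sub>M known {Output_Index})"
    proof -
      note [measurable] = measurable_grad_sq[of k] A
      show ?thesis by measurable
    qed
    have "(\<integral>\<^sup>+p. ennreal (grad_sq k p) * of_bool (a p = k) \<partial>M) =
        (\<integral>\<^sup>+p. \<integral>\<^sup>+p'. ennreal (grad_sq k p) * of_bool (a p' = k) \<partial>M \<partial>M)"
      by (rule nn_integral_indep_diagonal[OF indep space_known space_known \<Phi>])
    also have "\<dots> = (\<integral>\<^sup>+p. ennreal (grad_sq k p) * ennreal (1 / real K) \<partial>M)"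
      using k by (intro nn_integral_cong) (simp add: nn_integral_cmult output_index_probability)
    also have "\<dots> = (\<integral>\<^sup>+p. ennreal (grad_sq k p) \<partial>M) * ennreal (1 / real K)"
      by (rule nn_integral_multc) measurable
    finally show "(\<integral>\<^sup>+p. ennreal (grad_sq k p) * of_bool (a p = k) \<partial>M) =
        (\<integral>\<^sup>+p. ennreal (grad_sq k p) \<partial>M) * ennreal (1 / real K)" .
  qed
  finally show ?thesis
    by (simp add: sum_distrib_right)
qed

lemma output_gradient_bound:
  "integrable M (\<lambda>p. grad_sq (a p) p)"
  "expectation (\<lambda>p. grad_sq (a p) p) \<le> 4 * (objective n m f x0 - fmin) / (\<gamma> * real K)"
proof -
  let ?D = "objective n m f x0 - fmin" and ?S = "\<Sum>k<K. \<integral>\<^sup>+p. ennreal (grad_sq k p) \<partial>M"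
  have D0: "?D \<ge> 0"
    using fmin[of x0] by simp
  have [measurable]: "a \<in> measurable M (count_space UNIV)"
    by (rule measurable_knownI[OF _ measurable_output_index[of "{Output_Index}"]]) (auto simp: draws_def)
  have [measurable]: "grad_sq k \<in> borel_measurable M" for k
    by (rule measurable_knownI[OF past_draws_subset measurable_grad_sq])
  have meas: "(\<lambda>p. grad_sq (a p) p) \<in> borel_measurable M"
    by (rule measurable_compose_countable[where f="\<lambda>k p. grad_sq k p"]) measurable
  have "ennreal (\<gamma> / 4) * ?S = (\<Sum>k<K. \<integral>\<^sup>+p. ennreal (\<gamma> / 4 * grad_sq k p) \<partial>M)"
  proof -
    have "ennreal (\<gamma> / 4) * (\<integral>\<^sup>+p. ennreal (grad_sq k p) \<partial>M) = (\<integral>\<^sup>+p. ennreal (\<gamma> / 4 * grad_sq k p) \<partial>M)" for k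
      using \<gamma>_pos by (subst nn_integral_cmult[symmetric]) (auto simp: ennreal_mult[symmetric] grad_sq_nonneg)
    then show ?thesis
      by (simp only: sum_distrib_left)
  qed
  also have "\<dots> \<le> ennreal ?D"
    by (rule sum_expected_grad_sq)
  finally have "ennreal (4 / \<gamma>) * (ennreal (\<gamma> / 4) * ?S) \<le> ennreal (4 / \<gamma>) * ennreal ?D"
    by (rule mult_left_mono) simp
  moreover have "ennreal (4 / \<gamma>) * (ennreal (\<gamma> / 4) * ?S) = ?S"
    using \<gamma>_pos by (simp add: mult.assoc[symmetric] ennreal_mult[symmetric])
  ultimately have "?S * ennreal (1 / real K) \<le> (ennreal (4 / \<gamma>) * ennreal ?D) * ennreal (1 / real K)"
    by (intro mult_right_mono) auto
  also have "\<dots> = ennreal (4 * ?D / (\<gamma> * real K))"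
    using D0 \<gamma>_pos by (simp add: ennreal_mult[symmetric])
  finally have bound: "(\<integral>\<^sup>+p. ennreal (grad_sq (a p) p) \<partial>M) \<le> ennreal (4 * ?D / (\<gamma> * real K))"
    by (simp add: nn_integral_output)
  show int: "integrable M (\<lambda>p. grad_sq (a p) p)"
    using meas grad_sq_nonneg le_less_trans[OF bound] by (intro integrableI_nonneg) auto
  have "ennreal (expectation (\<lambda>p. grad_sq (a p) p)) \<le> ennreal (4 * ?D / (\<gamma> * real K))"
    using bound nn_integral_eq_integral[OF int] grad_sq_nonneg by simp
  then show "expectation (\<lambda>p. grad_sq (a p) p) \<le> 4 * ?D / (\<gamma> * real K)"
    using D0 \<gamma>_pos by (subst (asm) ennreal_le_iff) auto
qed

end

theorem theorem4:
  fixes f :: "nat \<Rightarrow> nat \<Rightarrow> real ^ 'd \<Rightarrow> real"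
    and Q :: "'r \<Rightarrow> real ^ 'd \<Rightarrow> real ^ 'd" and R :: "'r measure"
    and M :: "'p measure"
    and var :: variant
    and L \<omega> \<alpha> \<gamma> :: real
    and n m K :: nat
    and x0 xstar :: "real ^ 'd" and h0 :: "nat \<Rightarrow> real ^ 'd" and w0 :: "nat \<Rightarrow> nat \<Rightarrow> real ^ 'd"
    and u :: "nat \<Rightarrow> 'p \<Rightarrow> bool" and J :: "nat \<Rightarrow> nat \<Rightarrow> 'p \<Rightarrow> nat" and \<xi> :: "nat \<Rightarrow> nat \<Rightarrow> 'p \<Rightarrow> 'r"
    and a :: "'p \<Rightarrow> nat"
  defines "X \<equiv> \<lambda>p k. iterate (vr_diana var \<alpha> \<gamma> n m f Q x0 h0 w0
                          (\<lambda>k. u k p) (\<lambda>k i. J k i p) (\<lambda>k i. \<xi> k i p) k)"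
  assumes "n \<ge> 1" and "m \<ge> 1" and "K \<ge> 1" and "L > 0"
    and smooth: "\<And>i j. i \<in> {1..n} \<Longrightarrow> j \<in> {1..m} \<Longrightarrow> L_smooth L (f i j)"
    and lipschitz: "\<And>i j. i \<in> {1..n} \<Longrightarrow> j \<in> {1..m} \<Longrightarrow> L-lipschitz_on UNIV (gradient (f i j))"
    and minimizer: "\<And>y. objective n m f xstar \<le> objective n m f y"
    and quantizer: "quantization_operator \<omega> R Q"
    and gamma: "\<gamma> = 1 / (10 * L * sqrt (1 + \<omega> / real n) * (real m powr (2 / 3) + \<omega> + 1))"
    and alpha: "\<alpha> = 1 / (\<omega> + 1)"
    and init_w: "\<And>i j. i \<in> {1..n} \<Longrightarrow> j \<in> {1..m} \<Longrightarrow> w0 i j = x0"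
    and init_h: "\<And>i. i \<in> {1..n} \<Longrightarrow> h0 i = gradient (worker_obj m f i) x0"
    and "prob_space M"
    and draws: "random_draws M var n m R K u J \<xi> a"
  shows "integrable M (\<lambda>p. (norm (gradient (objective n m f) (X p (a p))))\<^sup>2) \<and>
         prob_space.expectation M (\<lambda>p. (norm (gradient (objective n m f) (X p (a p))))\<^sup>2)
           \<le> 40 * (objective n m f x0 - objective n m f xstar) * L * sqrt (1 + \<omega> / real n)
                * (real m powr (2 / 3) + \<omega> + 1) / real K"
proof -
  interpret prob_space M
    by fact
  interpret vr_diana_process M var n m R K u J \<xi> a f L Q \<omega> \<alpha> \<gamma> x0 h0 w0 "objective n m f xstar"
    by unfold_locales (use assms in auto)
  have "(norm (gradient (objective n m f) (X p (a p))))\<^sup>2 = grad_sq (a p) p" for p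
    by (simp add: X_def grad_sq_def state_def)
  moreover have "4 * (objective n m f x0 - objective n m f xstar) / (\<gamma> * real K) =
      40 * (objective n m f x0 - objective n m f xstar) * L * sqrt (1 + \<omega> / real n)
        * (real m powr (2 / 3) + \<omega> + 1) / real K"
  proof -
    have "4 * D / (1 / (10 * L * s * q) * k) = 40 * D * L * s * q / k" for D s q k :: real
      by simp
    then show ?thesis
      unfolding gamma .
  qed
  ultimately show ?thesis
    using output_gradient_bound by simp
qed

end
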